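(* There exist framed knots $K_1,K_2$ in $S^3$ with the same Kauffman bracket, $\langle K_1\rangle=\langle K_2\rangle$, but whose framed homologies differ: $\mathcal H^F_*(K_1)\not\cong\mathcal H^F_*(K_2)$ as pairs of graded abelian groups.
   Context: Links are in $S^3$; a diagram is an unoriented planar link diagram and represents the framed link given by the blackboard framing. Equivalence of framed links is isotopy in $S^3$ respecting framings. Graded abelian groups are $\mathbb Z$-graded, morphisms have degree $0$, and $G\{l\}$ is the shift $(G\{l\})_j=G_{j-l}$. For $i\in\{0,1\}$ write $\underline i=1-i$. A $2$-complex of graded abelian groups is $(A_0,A_1,\partial_0,\partial_1)$ with $\partial_0:A_0\to A_1$, $\partial_1:A_1\to A_0$ degree-$0$ homomorphisms with $\partial_1\partial_0=0$ and $\partial_0\partial_1=0$. Its homology is $H_*(A)=(H_0(A),H_1(A))$ with $H_i(A)=\ker\partial_i/\operatorname{im}\partial_{\underline i}$. Two pairs $(G_0,G_1)$, $(G_0',G_1')$ are isomorphic if $G_i\cong G_i'$ as graded abelian groups for $i=0,1$. Let $W$ be the free graded abelian group with basis $w_+$ in degree $2$ and $w_-$ in degree $-2$. Define degree-$2$ maps $\bar m:W\otimes W\to W$, $w_-\otimes w_-\mapsto w_-$, $w_+\otimes w_-\mapsto w_+$, $w_-\otimes w_+\mapsto w_+$, $w_+\otimes w_+\mapsto 0$; and $\bar\Delta:W\to W\otimes W$, $w_-\mapsto w_+\otimes w_-+w_-\otimes w_+$, $w_+\mapsto w_+\otimes w_+$. A Kauffman state $s$ of $D$ marks each crossing with $A$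 (or $0$) or $B$ (or $1$). Splitting each crossing according to its mark (the $A$-splitting joins the two regions swept by the overcrossing strand when rotated counterclockwise towards the undercrossing strand, the $B$-splitting joins the other two) gives a collection $D_s$ of $|s|$ disjoint circles. $a(s)$, $b(s)$ are the numbers of crossings marked $A$, $B$; $s_A$ is the state with all marks $A$. The Kauffman bracket of a nonempty diagram is $\langle D\rangle=\sum_s A^{a(s)-b(s)}(-A^2-A^{-2})^{|s|-1}$; it is an invariant of framed links, and $\langle L\rangle$ denotes $\langle D\rangle$ for any diagram $D$ of the framed link $L$. Put $W_s(D)=\big(\bigotimes_{\text{circles of }D_s}W\big)\{a(s)-b(s)\}$, and for $i\in\{0,1\}$ $$\langle\!\langle D\rangle\!\rangle_i=\bigoplus_{s:\ b(s)+|s_A|\in 2\mathbb Z+i}W_s(D).$$ An edge $\xi:s_0\to s_1$ is a pair of states differing at exactly one crossing, marked $A$ in $s_0$ and $B$ in $s_1$; $|\xi|=b(s_0)$. Passing from $D_{s_0}$ to $D_{s_1}$ either merges two circles into one or splits one circle into two; $\partial_\xi:W_{s_0}(D)\to W_{s_1}(D)$ (degree $0$ after the shifts) is $\bar m$, respectively $\bar\Delta$, on the factors of these circles and the identity on all other factors. Given an order of the crossings, $(-1)^\xi$ is $-1$ to the number of crossings marked $B$ in $s_0$ that precede the changing crossing. Set $\partial_i=\sum_{\xi:\ |\xi|+|s_A|\in 2\mathbb Z+i}(-1)^\xi\partial_\xi:\langle\!\langle D\rangle\!\rangle_i\to\langle\!\langle D\rangle\!\rangle_{\underline i}$ and $\langle\!\langle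 D\rangle\!\rangle=(\langle\!\langle D\rangle\!\rangle_0,\langle\!\langle D\rangle\!\rangle_1,\partial_0,\partial_1)$, a $2$-complex of graded abelian groups. For a framed link $L$, $\mathcal H^F_*(L)$ is the isomorphism class of the pair of graded abelian groups $H_*(\langle\!\langle D\rangle\!\rangle)$, where $D$ is any diagram of $L$ with any order of crossings (this does not depend on the choices). *)

theory Defs
  imports
    "HOL-Analysis.Analysis"
    "HOL-Algebra.Free_Abelian_Groups"
    "HOL-Computational_Algebra.Formal_Laurent_Series"
begin

section \<open>Framed knots in the 3-sphere\<close>

text \<open>Horizontal plane times height is the oriented 3-space \<open>\<complex> \<times> \<real>\<close>; the 3-sphere is the unit
  sphere of \<open>\<complex> \<times> \<real> \<times> \<real>\<close>, and \<open>to_S3\<close> is inverse stereographic projection.\<close>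

type_synonym space4 = "complex \<times> real \<times> real"

definition S3 :: "space4 set" where
  "S3 = sphere 0 1"

definition to_S3 :: "complex \<times> real \<Rightarrow> space4" where
  "to_S3 p = (1 / (1 + (norm p)\<^sup>2)) *\<^sub>R (2 *\<^sub>R fst p, 2 * snd p, (norm p)\<^sup>2 - 1)"

text \<open>A framed knot is an embedded annulus: the first coordinate runs once around the circle
  \<open>{0..1}\<close> modulo \<open>0 = 1\<close>, the second one across the band. The core is the knot, the band
  its framing.\<close>

definition framed_knot :: "(real \<times> real \<Rightarrow> space4) \<Rightarrow> bool" where
  "framed_knot K \<longleftrightarrow>
     continuous_on ({0..1} \<times> {0..1}) K \<and>
     (\<forall>w\<in>{0..1}. K (0, w) = K (1, w)) \<and>
     inj_on K ({0..<1} \<times> {0..1}) \<and>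
     K ` ({0..1} \<times> {0..1}) \<subseteq> S3"

text \<open>Ambient isotopy of \<open>S\<^sup>3\<close>. Comparing the bands as sets makes the notion unoriented.\<close>

definition framed_isotopic ::
    "(real \<times> real \<Rightarrow> space4) \<Rightarrow> (real \<times> real \<Rightarrow> space4) \<Rightarrow> bool" where
  "framed_isotopic K K' \<longleftrightarrow>
     (\<exists>H :: real \<Rightarrow> space4 \<Rightarrow> space4.
        continuous_on ({0..1} \<times> S3) (\<lambda>(t, x). H t x) \<and>
        (\<forall>t\<in>{0..1}. \<exists>G. homeomorphism S3 S3 (H t) G) \<and>
        (\<forall>x\<in>S3. H 0 x = x) \<and>
        H 1 ` (K ` ({0..1} \<times> {0..1})) = K' ` ({0..1} \<times> {0..1}))"


section \<open>Link diagrams\<close>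

text \<open>Planar diagram codes. \<open>Cr a b c d\<close> lists the arcs (edges of the underlying 4-valent graph)
  at a crossing counterclockwise, \<open>a\<close> and \<open>c\<close> being the two ends of the undercrossing strand.
  A member of \<open>arcs D\<close> that meets no crossing is a component without crossings. The list of
  crossings also fixes their order.\<close>

datatype crossing = Cr nat nat nat nat

record diagram =
  arcs :: "nat set"
  crossings :: "crossing list"

abbreviation ncross :: "diagram \<Rightarrow> nat" where
  "ncross D \<equiv> length (crossings D)"

text \<open>\<open>knot_projection D g h\<close>: the closed curve \<open>t \<mapsto> (g t, h t)\<close> projects to the plane with finitely
  many crossings, all of them transverse double points, and \<open>D\<close> is the resulting diagram.
  The curve passes through crossings at the times \<open>t 0 < t 1 < \<dots>\<close>; the crossing number \<open>k\<close> is passed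
  below at time number \<open>u k\<close> and above at time number \<open>v k\<close>. The arc leaving at time number \<open>i\<close> is
  \<open>lab i\<close>. If the upper strand, with velocity \<open>q\<close>, goes from left to right
  across the lower one, with velocity \<open>p\<close>, then the arc following the incoming lower arc in
  counterclockwise order is the outgoing upper arc; otherwise it is the incoming one.
  Either end of the lower strand may be listed first.\<close>

definition knot_projection :: "diagram \<Rightarrow> (real \<Rightarrow> complex) \<Rightarrow> (real \<Rightarrow> real) \<Rightarrow> bool" where
  "knot_projection D g h \<longleftrightarrow>
     path g \<and> pathstart g = pathfinish g \<and> path h \<and> pathstart h = pathfinish h \<and>
     (\<exists>(t :: nat \<Rightarrow> real) (u :: nat \<Rightarrow> nat) (v :: nat \<Rightarrow> nat) (lab :: nat \<Rightarrow> nat).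
        let n = ncross D;
            out = lab;
            inc = (\<lambda>i. lab ((i + 2 * n - 1) mod (2 * n)))
        in strict_mono_on {..<2 * n} t \<and> t ` {..<2 * n} \<subseteq> {0<..<1} \<and>
           bij_betw lab {..<max 1 (2 * n)} (arcs D) \<and>
           bij_betw (case_sum u v) ({..<n} <+> {..<n}) {..<2 * n} \<and>
           (\<forall>x\<in>{0..<1}. \<forall>y\<in>{0..<1}. x < y \<longrightarrow>
              (g x = g y \<longleftrightarrow> (\<exists>k<n. {x, y} = {t (u k), t (v k)}))) \<and>
           (\<forall>k<n. h (t (u k)) < h (t (v k)) \<and>
              (\<exists>p q. (g has_vector_derivative p) (at (t (u k))) \<and>
                     (g has_vector_derivative q) (at (t (v k))) \<and>
                     Im (cnj p * q) \<noteq> 0 \<and>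
                     (let a = inc (u k); c = out (u k);
                          b = (if Im (cnj p * q) < 0 then out (v k) else inc (v k));
                          d = (if Im (cnj p * q) < 0 then inc (v k) else out (v k))
                      in crossings D ! k = Cr a b c d \<or> crossings D ! k = Cr c d a b))))"

text \<open>The vertical framing used here is isotopic to the blackboard framing: rotate the normal
  direction by a quarter turn around the tangent.\<close>

definition vertical_band :: "(real \<Rightarrow> complex) \<Rightarrow> (real \<Rightarrow> real) \<Rightarrow> real \<Rightarrow> real \<times> real \<Rightarrow> space4" where
  "vertical_band g h \<delta> = (\<lambda>(t, w). to_S3 (g t, h t + \<delta> * w))"

definition diagram_of :: "diagram \<Rightarrow> (real \<times> real \<Rightarrow> space4) \<Rightarrow> bool" where
  "diagram_of D K \<longleftrightarrow>
     (\<exists>g h \<delta>. knot_projection D g h \<and> \<delta> > 0 \<and>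
        framed_knot (vertical_band g h \<delta>) \<and> framed_isotopic (vertical_band g h \<delta>) K)"


section \<open>Kauffman states and the Kauffman bracket\<close>

text \<open>A state is the set of (indices of) crossings marked \<open>B\<close>. Rotating the strand \<open>b d\<close> of
  \<open>Cr a b c d\<close> counterclockwise sweeps the regions between \<open>b\<close>, \<open>c\<close> and between \<open>d\<close>, \<open>a\<close>; joining
  these connects \<open>a\<close> with \<open>b\<close> and \<open>c\<close> with \<open>d\<close>.\<close>

definition states :: "diagram \<Rightarrow> nat set set" where
  "states D = Pow {..<ncross D}"

definition spliced :: "diagram \<Rightarrow> nat set \<Rightarrow> nat \<Rightarrow> nat \<Rightarrow> bool" where
  "spliced D s e e' \<longleftrightarrow>
     (\<exists>k<ncross D. case crossings D ! k of Cr a b c d \<Rightarrow>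
        (e, e') \<in> (if k \<in> s then {(a, d), (b, c)} else {(a, b), (c, d)}))"

text \<open>A circle of \<open>D\<^sub>s\<close> is represented by the set of arcs it consists of.\<close>

definition circ :: "diagram \<Rightarrow> nat set \<Rightarrow> nat \<Rightarrow> nat set" where
  "circ D s e = {e'. equivclp (spliced D s) e e'}"

definition circles :: "diagram \<Rightarrow> nat set \<Rightarrow> nat set set" where
  "circles D s = circ D s ` arcs D"

definition a_minus_b :: "diagram \<Rightarrow> nat set \<Rightarrow> int" where
  "a_minus_b D s = int (card ({..<ncross D} - s)) - int (card s)"

text \<open>Laurent polynomials in \<open>A\<close> are taken inside the formal Laurent series over the integers.\<close>

definition kauffman_bracket :: "diagram \<Rightarrow> int fls" where
  "kauffman_bracket D =
     (\<Sum>s\<in>states D. fls_X_intpow (a_minus_b D s) *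
        (- fls_X_intpow 2 - fls_X_intpow (- 2)) ^ (card (circles D s) - 1))"


section \<open>2-complexes of graded abelian groups\<close>

text \<open>A graded abelian group is the family of its homogeneous pieces; isomorphisms have degree 0.\<close>

type_synonym 'a graded_group = "int \<Rightarrow> 'a monoid"

definition graded_iso :: "'a graded_group \<Rightarrow> 'b graded_group \<Rightarrow> bool" where
  "graded_iso G G' \<longleftrightarrow> (\<forall>j. G j \<cong> G' j)"

text \<open>Only the indices 0 and 1 matter. A single function \<open>bdry i\<close> acts on all homogeneous pieces.\<close>

record 'a two_complex =
  chain :: "nat \<Rightarrow> 'a graded_group"
  bdry :: "nat \<Rightarrow> 'a \<Rightarrow> 'a"

definition homology :: "'a two_complex \<Rightarrow> nat \<Rightarrow> 'a set graded_group" where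
  "homology C i j =
     (chain C i j)\<lparr>carrier := kernel (chain C i j) (chain C (1 - i) j) (bdry C i)\<rparr>
       Mod (bdry C (1 - i) ` carrier (chain C (1 - i) j))"

definition pair_iso :: "(nat \<Rightarrow> 'a graded_group) \<Rightarrow> (nat \<Rightarrow> 'b graded_group) \<Rightarrow> bool" where
  "pair_iso G G' \<longleftrightarrow> graded_iso (G 0) (G' 0) \<and> graded_iso (G 1) (G' 1)"


section \<open>The framed complex of a diagram\<close>

datatype wgen = Wplus | Wminus

fun wdeg :: "wgen \<Rightarrow> int" where
  "wdeg Wplus = 2"
| "wdeg Wminus = - 2"

text \<open>Values on basis elements; \<open>W \<otimes> W\<close> is the free abelian group on pairs of basis elements.\<close>

fun mbar :: "wgen \<Rightarrow> wgen \<Rightarrow> (wgen \<Rightarrow>\<^sub>0 int)" where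
  "mbar Wminus Wminus = frag_of Wminus"
| "mbar Wplus Wminus = frag_of Wplus"
| "mbar Wminus Wplus = frag_of Wplus"
| "mbar Wplus Wplus = 0"

fun \<Delta>bar :: "wgen \<Rightarrow> (wgen \<times> wgen \<Rightarrow>\<^sub>0 int)" where
  "\<Delta>bar Wminus = frag_of (Wplus, Wminus) + frag_of (Wminus, Wplus)"
| "\<Delta>bar Wplus = frag_of (Wplus, Wplus)"

text \<open>The tensor power of \<open>W\<close> over the circles of \<open>D\<^sub>s\<close> is free on the assignments of
  basis elements to circles; a basis element of the complex is a state with such an assignment.\<close>

type_synonym enhanced = "nat set \<times> (nat set \<Rightarrow> wgen)"

definition edeg :: "diagram \<Rightarrow> enhanced \<Rightarrow> int" where
  "edeg D = (\<lambda>(s, \<epsilon>). (\<Sum>Z\<in>circles D s. wdeg (\<epsilon> Z)) + a_minus_b D s)"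

definition W_basis :: "diagram \<Rightarrow> nat set \<Rightarrow> (nat set \<Rightarrow> wgen) set" where
  "W_basis D s = (circles D s \<rightarrow>\<^sub>E UNIV)"

definition framed_basis :: "diagram \<Rightarrow> nat \<Rightarrow> int \<Rightarrow> enhanced set" where
  "framed_basis D i j =
     {(s, \<epsilon>). s \<in> states D \<and> \<epsilon> \<in> W_basis D s \<and>
        (card s + card (circles D {})) mod 2 = i \<and> edeg D (s, \<epsilon>) = j}"

text \<open>The map of the edge that changes the mark of crossing \<open>k\<close> of \<open>s\<close> from \<open>A\<close> to \<open>B\<close>,
  on a basis element.\<close>

definition edge_map :: "diagram \<Rightarrow> nat set \<Rightarrow> nat \<Rightarrow> (nat set \<Rightarrow> wgen) \<Rightarrow> (enhanced \<Rightarrow>\<^sub>0 int)" where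
  "edge_map D s k \<epsilon> =
     (let s' = insert k s in
      case crossings D ! k of Cr a b c d \<Rightarrow>
        if circ D s a \<noteq> circ D s c
        then frag_extend
               (\<lambda>x. frag_of (s', \<lambda>Z\<in>circles D s'. if Z = circ D s' a then x else \<epsilon> Z))
               (mbar (\<epsilon> (circ D s a)) (\<epsilon> (circ D s c)))
        else frag_extend
               (\<lambda>(x, y). frag_of (s', \<lambda>Z\<in>circles D s'.
                  if Z = circ D s' a then x else if Z = circ D s' c then y else \<epsilon> Z))
               (\<Delta>bar (\<epsilon> (circ D s a))))"

text \<open>The parity condition on the edges in \<open>\<partial>\<^sub>i\<close> holds automatically on the chains of index \<open>i\<close>,
  so one formula serves for both values of \<open>i\<close>.\<close>

definition framed_boundary :: "diagram \<Rightarrow> (enhanced \<Rightarrow>\<^sub>0 int) \<Rightarrow> (enhanced \<Rightarrow>\<^sub>0 int)" where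
  "framed_boundary D =
     frag_extend (\<lambda>(s, \<epsilon>). \<Sum>k\<in>{..<ncross D} - s.
       frag_cmul ((- 1) ^ card {l\<in>s. l < k}) (edge_map D s k \<epsilon>))"

definition framed_complex :: "diagram \<Rightarrow> (enhanced \<Rightarrow>\<^sub>0 int) two_complex" where
  "framed_complex D =
     \<lparr>chain = (\<lambda>i j. free_Abelian_group (framed_basis D i j)),
      bdry = (\<lambda>i. framed_boundary D)\<rparr>"

definition framed_homology :: "diagram \<Rightarrow> nat \<Rightarrow> (enhanced \<Rightarrow>\<^sub>0 int) set graded_group" where
  "framed_homology D = homology (framed_complex D)"

end

(* The knots are the torus knot T(2,5) and the knot 10_132 (with the chirality that gives it the
   Jones polynomial of T(2,5)), both with blackboard framing 5. The standard diagram of T(2,5) has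
   no basis element in degree 13. For 10_132 take the Seifert state of a suitable diagram with 11
   crossings: one of its 8 circles, c, meets negative crossings only, and the graph of the other
   seven circles and the positive crossings is connected and bipartite. Marking c and one other
   circle with w_- and summing over the other circle, with signs given by the bipartition, gives a
   cycle of degree 13. All edges into the Seifert state are comultiplications, and a functional
   supported on that state kills their images but takes the value -2 on the cycle.

   Geometrically both diagrams are grid diagrams: closed rectilinear curves whose vertical segments
   pass over the horizontal ones. *)
theory Submission
  imports Defs
begin

section \<open>Framed knots from projections\<close>

text \<open>The knots are a classical pair with equal Jones polynomials and different Khovanov
  homology. Their diagrams have equal writhe (5 positive crossings against 8 positive and 3 negative
  ones), so the brackets agree exactly and not just up to a power of -A^3. Computing the homology of
  a complex over 2^11 states is avoided: where one knot has no chains its homology is a single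
  class, and a second class for the other knot already excludes a bijection. Keeping the cycle and
  the functional on one state makes both conditions local: the edges leaving it are merges at the 8
  positive crossings, the edges entering it are splittings at the 3 negative ones. The value -2
  reflects that the two neighbours of c in the Seifert graph lie on the same side of its
  bipartition, so their contributions add up. The geometric task is to show that the codes come from
  actual curves. For rectilinear curves with integer coordinates this reduces to finitely many
  checks on fractions, and a vertical band needs no normal direction at the corners.\<close>

lemma norm_to_S3: "norm (to_S3 p) = 1"
proof -
  define n where "n = (norm p)\<^sup>2"
  have n: "n = (norm (fst p))\<^sup>2 + (snd p)\<^sup>2" and n0: "n \<ge> 0"
    unfolding n_def by (cases p; simp add: norm_Pair) simp
  have "(norm (2 *\<^sub>R fst p, 2 * snd p, n - 1))\<^sup>2 = 4 * n + (n - 1)\<^sup>2"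
    unfolding n by (simp add: norm_Pair power_mult_distrib)
  also have "\<dots> = (1 + n)\<^sup>2" by (simp add: power2_eq_square algebra_simps)
  finally have "norm (2 *\<^sub>R fst p, 2 * snd p, n - 1) = 1 + n"
    using n0 by (simp add: power2_eq_iff_nonneg)
  then show ?thesis using n0 unfolding to_S3_def n_def[symmetric] norm_scaleR by simp
qed

text \<open>The last coordinate (n - 1) / (1 + n) determines the squared norm n, and with it the
  factor that scales the other coordinates.\<close>

lemma inj_to_S3: "inj to_S3"
proof (rule injI)
  fix p q assume eq: "to_S3 p = to_S3 q"
  define n m where "n = (norm p)\<^sup>2" and "m = (norm q)\<^sup>2"
  have pos: "1 + n > 0" "1 + m > 0" unfolding n_def m_def by (simp_all add: add_pos_nonneg)
  have "(n - 1) / (1 + n) = (m - 1) / (1 + m)"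
    using eq unfolding to_S3_def n_def[symmetric] m_def[symmetric] by simp
  then have "n = m" using pos by (simp add: field_simps)
  then have "fst p = fst q" "snd p = snd q"
    using eq pos unfolding to_S3_def n_def[symmetric] m_def[symmetric] by auto
  then show "p = q" by (simp add: prod_eq_iff)
qed

lemma continuous_on_to_S3: "continuous_on A to_S3"
proof -
  have "1 + (norm (p :: complex \<times> real))\<^sup>2 \<noteq> 0" for p
    by (metis add_pos_nonneg less_irrefl zero_le_power2 zero_less_one)
  then show ?thesis unfolding to_S3_def by (intro continuous_intros) auto
qed

lemma framed_isotopic_refl: "framed_isotopic K K"
  unfolding framed_isotopic_def
proof (intro exI[of _ "\<lambda>t x. x"] conjI ballI)
  show "continuous_on ({0..1} \<times> S3) (\<lambda>(t, x). x)"
    by (simp add: case_prod_unfold continuous_on_snd)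
  show "\<exists>G. homeomorphism S3 S3 (\<lambda>x. x) G"
    by (rule exI[of _ "\<lambda>x. x"]) (simp add: homeomorphism_def)
qed auto

text \<open>A vertical band thinner than every height gap at a crossing is embedded. The band itself
  then serves as \<open>K\<close>, with the constant isotopy.\<close>

lemma diagram_of_vertical_band:
  assumes "knot_projection D g h"
  obtains K where "framed_knot K" "diagram_of D K"
proof -
  have gc: "path g" "pathstart g = pathfinish g" and hc: "path h" "pathstart h = pathfinish h"
    using assms unfolding knot_projection_def by simp_all
  obtain t :: "nat \<Rightarrow> real" and u v :: "nat \<Rightarrow> nat" where
    dbl': "\<forall>x\<in>{0..<1}. \<forall>y\<in>{0..<1}. x < y \<longrightarrow> (g x = g y \<longleftrightarrow> (\<exists>k<ncross D. {x, y} = {t (u k), t (v k)}))"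
    and over': "\<forall>k<ncross D. h (t (u k)) < h (t (v k))"
    using assms unfolding knot_projection_def Let_def
    apply (elim conjE exE)
    subgoal premises p for t u v lab
      by (rule p(1)[of t u v]) (use p in simp_all)
    done
  \<comment> \<open>The entry 1 keeps the set nonempty for a curve without crossings.\<close>
  define gaps where "gaps = insert 1 ((\<lambda>k. h (t (v k)) - h (t (u k))) ` {..<ncross D})"
  define \<delta> where "\<delta> = Min gaps / 2"
  have "Min gaps > 0" unfolding gaps_def using over' by (subst Min_gr_iff) auto
  then have \<delta>: "\<delta> > 0" "\<delta> < Min gaps" unfolding \<delta>_def by auto
  have gap: "\<delta> < h (t (v k)) - h (t (u k))" if "k < ncross D" for k
    using \<delta>(2) that unfolding gaps_def by (auto simp: less_le_trans)
  have no_meet: "h x + \<delta> * w \<noteq> h y + \<delta> * w'"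
    if xy: "x \<in> {0..<1}" "y \<in> {0..<1}" "x < y" "g x = g y" "w \<in> {0..1}" "w' \<in> {0..1}" for x y w w'
  proof -
    obtain k where k: "k < ncross D" "{x, y} = {t (u k), t (v k)}"
      using dbl'[rule_format, OF xy(1-3)] xy(4) by auto
    then have "\<delta> < \<bar>h x - h y\<bar>" using gap[OF k(1)] \<delta>(1) unfolding doubleton_eq_iff by (elim disjE conjE) simp_all
    moreover have "\<bar>\<delta> * w' - \<delta> * w\<bar> \<le> \<delta>"
    proof -
      have "0 \<le> \<delta> * w" "\<delta> * w \<le> \<delta>" "0 \<le> \<delta> * w'" "\<delta> * w' \<le> \<delta>"
        using xy(5,6) \<delta>(1) by (simp_all add: mult_left_le)
      then show ?thesis by linarith
    qed
    ultimately show ?thesis by linarith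
  qed
  have "inj_on (vertical_band g h \<delta>) ({0..<1} \<times> {0..1})"
  proof (rule inj_onI, clarify)
    fix x w y w' assume m: "x \<in> {0..<1::real}" "w \<in> {0..1::real}" "y \<in> {0..<1::real}" "w' \<in> {0..1::real}"
      and "vertical_band g h \<delta> (x, w) = vertical_band g h \<delta> (y, w')"
    then have e: "g x = g y" "h x + \<delta> * w = h y + \<delta> * w'"
      using injD[OF inj_to_S3] by (fastforce simp: vertical_band_def)+
    then have "x = y" using no_meet[OF m(1,3)] no_meet[OF m(3,1)] m(2,4) e by (metis linorder_neqE)
    then show "x = y \<and> w = w'" using e \<delta>(1) by simp
  qed
  moreover have "continuous_on ({0..1} \<times> {0..1}) (vertical_band g h \<delta>)"
  proof -
    have g: "continuous_on ({0..1} \<times> {0..1 :: real}) (\<lambda>z. g (fst z))"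
      using gc(1) unfolding path_def
      by (rule continuous_on_compose2) (auto intro: continuous_on_fst continuous_on_id)
    have h: "continuous_on ({0..1} \<times> {0..1 :: real}) (\<lambda>z. h (fst z))"
      using hc(1) unfolding path_def
      by (rule continuous_on_compose2) (auto intro: continuous_on_fst continuous_on_id)
    have "continuous_on ({0..1} \<times> {0..1}) (\<lambda>z. to_S3 (g (fst z), h (fst z) + \<delta> * snd z))"
      by (rule continuous_on_compose2[OF continuous_on_to_S3[of UNIV]])
        (intro continuous_on_Pair g h continuous_on_add continuous_on_mult continuous_on_const
          continuous_on_snd continuous_on_id, simp)
    then show ?thesis unfolding vertical_band_def case_prod_unfold .
  qed
  moreover have "vertical_band g h \<delta> (0, w) = vertical_band g h \<delta> (1, w)" for w
    using gc(2) hc(2) by (simp add: vertical_band_def pathstart_def pathfinish_def)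
  moreover have "vertical_band g h \<delta> z \<in> S3" for z
    by (cases z) (simp add: vertical_band_def S3_def norm_to_S3)
  ultimately have "framed_knot (vertical_band g h \<delta>)"
    unfolding framed_knot_def by blast
  then show thesis
    using that assms \<delta>(1) framed_isotopic_refl unfolding diagram_of_def by blast
qed

section \<open>Grid diagrams\<close>

text \<open>Each summand is an increment clamped to its own unit of time, so continuity needs no
  pasting of segments.\<close>

definition polyline :: "nat \<Rightarrow> (nat \<Rightarrow> complex) \<Rightarrow> real \<Rightarrow> complex" where
  "polyline M P s = P 0 + (\<Sum>i<M. max 0 (min 1 (s - real i)) *\<^sub>R (P (Suc i) - P i))"

lemma polyline_eq:
  assumes "m < M" "0 \<le> \<alpha>" "\<alpha> \<le> 1"
  shows "polyline M P (real m + \<alpha>) = P m + \<alpha> *\<^sub>R (P (Suc m) - P m)"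
proof -
  let ?f = "\<lambda>i. max 0 (min 1 (real m + \<alpha> - real i)) *\<^sub>R (P (Suc i) - P i)"
  have "{..<M} = {..<m} \<union> {m} \<union> {Suc m..<M}" using assms(1) by auto
  moreover have "sum ?f ({..<m} \<union> {m} \<union> {Suc m..<M}) = sum ?f ({..<m} \<union> {m}) + sum ?f {Suc m..<M}"
    by (rule sum.union_disjoint) auto
  ultimately have "sum ?f {..<M} = sum ?f {..<m} + ?f m + sum ?f {Suc m..<M}" by simp
  also have "sum ?f {..<m} = (\<Sum>i<m. P (Suc i) - P i)"
  proof (rule sum.cong[OF refl])
    fix i assume "i \<in> {..<m}"
    then have "real i + 1 \<le> real m" by (simp add: Suc_leI flip: of_nat_Suc)
    then show "?f i = P (Suc i) - P i" using assms(2) by (simp add: min_def max_def)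
  qed
  also have "\<dots> = P m - P 0" by (rule sum_lessThan_telescope)
  also have "sum ?f {Suc m..<M} = 0"
  proof (rule sum.neutral, rule ballI)
    fix i assume "i \<in> {Suc m..<M}"
    then have "real m + 1 \<le> real i" by (simp flip: of_nat_Suc)
    then show "?f i = 0" using assms(3) by (simp add: min_def max_def)
  qed
  finally show ?thesis using assms(2,3) by (simp add: polyline_def)
qed

lemma continuous_on_polyline: "continuous_on A (polyline M P)"
  unfolding polyline_def by (intro continuous_intros)

text \<open>Segment number \<open>2 i\<close> runs horizontally at height \<open>Y i\<close> from \<open>X i\<close> to \<open>X (i + 1)\<close>,
  segment number \<open>2 j + 1\<close> vertically at \<open>X (j + 1)\<close> from \<open>Y j\<close> to \<open>Y (j + 1)\<close>. All vertical
  segments pass over all horizontal ones.\<close>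

locale grid =
  fixes N :: nat and X Y :: "nat \<Rightarrow> real"
  assumes N: "2 \<le> N"
    and X_inj: "inj_on X {..<N}" and X_N: "X N = X 0"
    and Y_inj: "inj_on Y {..<N}" and Y_N: "Y N = Y 0"
begin

definition corner :: "nat \<Rightarrow> complex" where
  "corner m = (if even m then Complex (X (m div 2)) (Y (m div 2))
               else Complex (X (Suc (m div 2))) (Y (m div 2)))"

definition curve :: "real \<Rightarrow> complex" where
  "curve t = polyline (2 * N) corner (2 * real N * t)"

text \<open>Segment number m occupies the scaled times from m to m + 1, so this is negative inside
  horizontal segments, positive inside vertical ones and 0 at the corners.\<close>

definition height :: "real \<Rightarrow> real" where
  "height t = - sin (pi * (2 * real N * t))"

text \<open>A negative product expresses strict betweenness whichever way the segment runs.\<close>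

definition crosses :: "nat \<Rightarrow> nat \<Rightarrow> bool" where
  "crosses i j \<longleftrightarrow> (X (Suc j) - X i) * (X (Suc j) - X (Suc i)) < 0 \<and>
                  (Y i - Y j) * (Y i - Y (Suc j)) < 0"

definition under_time :: "nat \<Rightarrow> nat \<Rightarrow> real" where
  "under_time i j = real (2 * i) + (X (Suc j) - X i) / (X (Suc i) - X i)"

definition over_time :: "nat \<Rightarrow> nat \<Rightarrow> real" where
  "over_time i j = real (2 * j + 1) + (Y i - Y j) / (Y (Suc j) - Y j)"

lemma X_Suc: "i < N \<Longrightarrow> j < N \<Longrightarrow> X (Suc i) = X j \<longleftrightarrow> (if Suc i = N then 0 else Suc i) = j"
  using N X_N inj_onD[OF X_inj, of "Suc i" j] inj_onD[OF X_inj, of 0 j] by auto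

lemma Y_Suc: "i < N \<Longrightarrow> j < N \<Longrightarrow> Y (Suc i) = Y j \<longleftrightarrow> (if Suc i = N then 0 else Suc i) = j"
  using N Y_N inj_onD[OF Y_inj, of "Suc i" j] inj_onD[OF Y_inj, of 0 j] by auto

lemma X_Suc_neq: "i < N \<Longrightarrow> X (Suc i) \<noteq> X i"
  using X_Suc[of i i] N by auto

lemma Y_Suc_neq: "i < N \<Longrightarrow> Y (Suc i) \<noteq> Y i"
  using Y_Suc[of i i] N by auto

lemma curve_horizontal:
  assumes "i < N" "0 \<le> \<alpha>" "\<alpha> \<le> 1" "2 * real N * t = real (2 * i) + \<alpha>"
  shows "curve t = Complex (X i + \<alpha> * (X (Suc i) - X i)) (Y i)"
  using polyline_eq[of "2 * i" "2 * N" \<alpha> corner] assms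
  by (simp add: curve_def corner_def complex_eq_iff)

lemma curve_vertical:
  assumes "j < N" "0 \<le> \<beta>" "\<beta> \<le> 1" "2 * real N * t = real (2 * j + 1) + \<beta>"
  shows "curve t = Complex (X (Suc j)) (Y j + \<beta> * (Y (Suc j) - Y j))"
  using polyline_eq[of "2 * j + 1" "2 * N" \<beta> corner] assms
  by (simp add: curve_def corner_def complex_eq_iff)

lemma segment_cases:
  assumes "t \<in> {0..<1}"
  obtains (horizontal) i \<alpha> where "i < N" "0 \<le> \<alpha>" "\<alpha> < 1" "2 * real N * t = real (2 * i) + \<alpha>"
    | (vertical) j \<beta> where "j < N" "0 \<le> \<beta>" "\<beta> < 1" "2 * real N * t = real (2 * j + 1) + \<beta>"
proof -
  define s where "s = 2 * real N * t"
  define m where "m = nat \<lfloor>s\<rfloor>"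
  have s: "0 \<le> s" "s < real (2 * N)" using assms N unfolding s_def by auto
  then have m: "real m \<le> s" "s < real m + 1" unfolding m_def by linarith+
  then have "m < 2 * N" using s(2) by linarith
  moreover obtain i where "m = 2 * i \<or> m = 2 * i + 1" by (meson oddE evenE)
  ultimately have "i < N \<and> (s = real (2 * i) + (s - real m) \<or> s = real (2 * i + 1) + (s - real m))"
    by auto
  then show thesis
    using horizontal[of i "s - real m"] vertical[of i "s - real m"] m unfolding s_def by auto
qed

lemma crosses_ratios:
  assumes "crosses i j"
  shows "0 < (X (Suc j) - X i) / (X (Suc i) - X i)" "(X (Suc j) - X i) / (X (Suc i) - X i) < 1"
    "0 < (Y i - Y j) / (Y (Suc j) - Y j)" "(Y i - Y j) / (Y (Suc j) - Y j) < 1"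
  using assms unfolding crosses_def mult_less_0_iff
  by (auto simp: divide_simps zero_less_divide_iff)

text \<open>Half-open segments keep the corners from counting as meetings. If \<alpha> = 0, the
  start of the horizontal segment lies on the vertical one, which by injectivity must be its
  predecessor and reaches that corner only at \<beta> = 1. If \<beta> = 0, the horizontal segment is
  the predecessor of the vertical one and \<alpha> would be 1.\<close>

lemma meet_iff:
  assumes ij: "i < N" "j < N" and \<alpha>: "0 \<le> \<alpha>" "\<alpha> < 1" and \<beta>: "0 \<le> \<beta>" "\<beta> < 1"
  shows "X i + \<alpha> * (X (Suc i) - X i) = X (Suc j) \<and> Y i = Y j + \<beta> * (Y (Suc j) - Y j) \<longleftrightarrow>
    crosses i j \<and> real (2 * i) + \<alpha> = under_time i j \<and> real (2 * j + 1) + \<beta> = over_time i j"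
    (is "?meet \<longleftrightarrow> ?cross")
proof
  assume meet: ?meet
  have ne: "X (Suc i) \<noteq> X i" "Y (Suc j) \<noteq> Y j" using ij by (simp_all add: X_Suc_neq Y_Suc_neq)
  have "\<alpha> \<noteq> 0"
  proof
    assume "\<alpha> = 0"
    then have "Y (Suc j) = Y i" using meet X_Suc[of j i] Y_Suc[of j i] ij by simp
    then have "(1 - \<beta>) * (Y (Suc j) - Y j) = 0" using meet by (simp add: algebra_simps)
    then show False using ne \<beta> by simp
  qed
  moreover have "\<beta> \<noteq> 0"
  proof
    assume "\<beta> = 0"
    then have "i = j" using meet ij Y_inj by (auto dest: inj_onD)
    then have "(1 - \<alpha>) * (X (Suc i) - X i) = 0" using meet by (simp add: algebra_simps)
    then show False using ne \<alpha> by simp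
  qed
  ultimately have pos: "0 < \<alpha>" "0 < \<beta>" using \<alpha> \<beta> by auto
  have "X (Suc j) - X i = \<alpha> * (X (Suc i) - X i)" "X (Suc j) - X (Suc i) = - (1 - \<alpha>) * (X (Suc i) - X i)"
    "Y i - Y j = \<beta> * (Y (Suc j) - Y j)" "Y i - Y (Suc j) = - (1 - \<beta>) * (Y (Suc j) - Y j)"
    using meet by (auto simp: algebra_simps)
  moreover have "a * d * (- (1 - a) * d) < 0" if "0 < a" "a < 1" "d \<noteq> 0" for a d :: real
  proof -
    have "a * (1 - a) * (d * d) > 0" using that by (auto simp: zero_less_mult_iff linorder_neq_iff)
    then show ?thesis by (simp add: algebra_simps)
  qed
  ultimately show ?cross
    using pos \<alpha> \<beta> ne unfolding crosses_def under_time_def over_time_def by simp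
next
  assume ?cross
  then show ?meet using X_Suc_neq[OF ij(1)] Y_Suc_neq[OF ij(2)]
    by (simp add: under_time_def over_time_def)
qed

lemma curve_eq_iff:
  assumes xy: "x \<in> {0..<1}" "y \<in> {0..<1}" "x \<noteq> y"
  shows "curve x = curve y \<longleftrightarrow>
    (\<exists>i<N. \<exists>j<N. crosses i j \<and> {2 * real N * x, 2 * real N * y} = {under_time i j, over_time i j})"
proof -
  have ne: "2 * real N * x \<noteq> 2 * real N * y" using xy(3) N by simp
  \<comment> \<open>Under times have even floor and over times odd floor, so two points on parallel
    segments never form the pair of times of a crossing.\<close>
  have no_cross: "\<not> {2 * real N * x, 2 * real N * y} = {under_time i j, over_time i j}"
    if "even \<lfloor>2 * real N * x\<rfloor> \<longleftrightarrow> even \<lfloor>2 * real N * y\<rfloor>" "crosses i j" for i j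
  proof -
    have "\<lfloor>under_time i j\<rfloor> = int (2 * i)" "\<lfloor>over_time i j\<rfloor> = int (2 * j + 1)"
      unfolding under_time_def over_time_def floor_eq_iff using crosses_ratios[OF that(2)] by auto
    then show ?thesis using that(1) by (auto simp: doubleton_eq_iff)
  qed
  have fl: "\<lfloor>real m + \<alpha>\<rfloor> = int m" if "0 \<le> \<alpha>" "\<alpha> < 1" for m \<alpha>
    using that by (simp add: floor_eq_iff)
  have mixed: "curve x' = curve y' \<longleftrightarrow>
    (\<exists>i<N. \<exists>j<N. crosses i j \<and> {2 * real N * x', 2 * real N * y'} = {under_time i j, over_time i j})"
    if h: "i < N" "0 \<le> \<alpha>" "\<alpha> < 1" "2 * real N * x' = real (2 * i) + \<alpha>"
      and v: "j < N" "0 \<le> \<beta>" "\<beta> < 1" "2 * real N * y' = real (2 * j + 1) + \<beta>" for x' y' i j \<alpha> \<beta>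
  proof -
    have "curve x' = curve y' \<longleftrightarrow>
      crosses i j \<and> 2 * real N * x' = under_time i j \<and> 2 * real N * y' = over_time i j"
      unfolding curve_horizontal[OF h(1,2) less_imp_le[OF h(3)] h(4)]
        curve_vertical[OF v(1,2) less_imp_le[OF v(3)] v(4)] complex.inject h(4) v(4)
      by (rule meet_iff; fact)
    also have "\<dots> \<longleftrightarrow> (\<exists>i<N. \<exists>j<N. crosses i j \<and>
        {2 * real N * x', 2 * real N * y'} = {under_time i j, over_time i j})"
    proof
      assume "\<exists>i<N. \<exists>j<N. crosses i j \<and>
        {2 * real N * x', 2 * real N * y'} = {under_time i j, over_time i j}"
      then obtain i' j' where c: "crosses i' j'"
        "{2 * real N * x', 2 * real N * y'} = {under_time i' j', over_time i' j'}" by blast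
      have f: "\<lfloor>under_time i' j'\<rfloor> = int (2 * i')" "\<lfloor>over_time i' j'\<rfloor> = int (2 * j' + 1)"
        unfolding under_time_def over_time_def floor_eq_iff using crosses_ratios[OF c(1)] by auto
      have g: "\<lfloor>2 * real N * x'\<rfloor> = int (2 * i)" "\<lfloor>2 * real N * y'\<rfloor> = int (2 * j + 1)"
        unfolding h(4) v(4) by (rule fl; fact)+
      have "2 * real N * x' \<noteq> over_time i' j'"
      proof
        assume "2 * real N * x' = over_time i' j'"
        then have "int (2 * i) = int (2 * j' + 1)" using f(2) g(1) by simp
        then show False by presburger
      qed
      then have e: "2 * real N * x' = under_time i' j'" "2 * real N * y' = over_time i' j'"
        using c(2) by (auto simp: doubleton_eq_iff)
      then have "i' = i" "j' = j" using f g by auto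
      then show "crosses i j \<and> 2 * real N * x' = under_time i j \<and> 2 * real N * y' = over_time i j"
        using c(1) e by simp
    next
      assume c: "crosses i j \<and> 2 * real N * x' = under_time i j \<and> 2 * real N * y' = over_time i j"
      show "\<exists>i<N. \<exists>j<N. crosses i j \<and>
        {2 * real N * x', 2 * real N * y'} = {under_time i j, over_time i j}"
        by (rule exI[of _ i], rule conjI[OF h(1)], rule exI[of _ j], rule conjI[OF v(1)]) (simp only: c simp_thms)
    qed
    finally show ?thesis .
  qed
  from xy(1) show ?thesis
  proof (cases rule: segment_cases)
    case (horizontal i \<alpha>)
    note h = this
    from xy(2) show ?thesis
    proof (cases rule: segment_cases)
      case (horizontal j \<beta>)
      have "curve x \<noteq> curve y"
      proof
        assume "curve x = curve y"
        then have e: "X i + \<alpha> * (X (Suc i) - X i) = X j + \<beta> * (X (Suc j) - X j)" "Y i = Y j"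
          unfolding curve_horizontal[OF h(1,2) less_imp_le[OF h(3)] h(4)] complex.inject
            curve_horizontal[OF horizontal(1,2) less_imp_le[OF horizontal(3)] horizontal(4)] by simp_all
        then have "i = j" using h(1) horizontal(1) Y_inj by (auto dest: inj_onD)
        then have "\<alpha> = \<beta>" using e(1) X_Suc_neq[OF h(1)] by simp
        then show False using ne h(4) horizontal(4) \<open>i = j\<close> by simp
      qed
      moreover have "even \<lfloor>2 * real N * x\<rfloor>" "even \<lfloor>2 * real N * y\<rfloor>"
        unfolding h(4) horizontal(4) fl[OF h(2,3)] fl[OF horizontal(2,3)] by simp_all
      ultimately show ?thesis using no_cross by blast
    next
      case (vertical j \<beta>)
      show ?thesis by (rule mixed[OF h vertical])
    qed
  next
    case (vertical i \<alpha>)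
    note v = this
    from xy(2) show ?thesis
    proof (cases rule: segment_cases)
      case (horizontal j \<beta>)
      show ?thesis using mixed[OF horizontal v]
        unfolding insert_commute[of "2 * real N * y"] eq_commute[of "curve y"] .
    next
      case (vertical j \<beta>)
      have "curve x \<noteq> curve y"
      proof
        assume "curve x = curve y"
        then have e: "X (Suc i) = X (Suc j)" "Y i + \<alpha> * (Y (Suc i) - Y i) = Y j + \<beta> * (Y (Suc j) - Y j)"
          unfolding curve_vertical[OF v(1,2) less_imp_le[OF v(3)] v(4)] complex.inject
            curve_vertical[OF vertical(1,2) less_imp_le[OF vertical(3)] vertical(4)] by simp_all
        have "i = j"
          using e(1) X_Suc[OF v(1), of "Suc j"] X_Suc[OF v(1), of 0] v(1) vertical(1) N X_N
          by (cases "Suc j = N") (auto split: if_splits)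
        then have "\<alpha> = \<beta>" using e(2) Y_Suc_neq[OF v(1)] by simp
        then show False using ne v(4) vertical(4) \<open>i = j\<close> by simp
      qed
      moreover have "odd \<lfloor>2 * real N * x\<rfloor>" "odd \<lfloor>2 * real N * y\<rfloor>"
        unfolding v(4) vertical(4) fl[OF v(2,3)] fl[OF vertical(2,3)] by simp_all
      ultimately show ?thesis using no_cross by blast
    qed
  qed
qed

lemma curve_has_vector_derivative:
  assumes "m < 2 * N" "0 < \<alpha>" "\<alpha> < 1" "2 * real N * t = real m + \<alpha>"
  shows "(curve has_vector_derivative (2 * real N) *\<^sub>R (corner (Suc m) - corner m)) (at t)"
proof -
  let ?d = "corner (Suc m) - corner m"
  let ?S = "{real m / (2 * real N) <..< (real m + 1) / (2 * real N)}"
  have "((\<lambda>s. corner m + (2 * real N * s - real m) *\<^sub>R ?d) has_vector_derivative (2 * real N) *\<^sub>R ?d) (at t)"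
    by (auto intro!: derivative_eq_intros simp: has_vector_derivative_def[symmetric])
  moreover have "t \<in> ?S" using assms N by (auto simp: field_simps)
  moreover have "corner m + (2 * real N * s - real m) *\<^sub>R ?d = curve s" if "s \<in> ?S" for s
  proof -
    have "0 \<le> 2 * real N * s - real m" "2 * real N * s - real m \<le> 1"
      using that N by (auto simp: field_simps)
    from polyline_eq[OF assms(1) this, of corner] show ?thesis by (simp add: curve_def)
  qed
  ultimately show ?thesis
    by (rule has_vector_derivative_transform_within_open[OF _ open_greaterThanLessThan])
qed

lemma height_under: "0 < \<alpha> \<Longrightarrow> \<alpha> < 1 \<Longrightarrow> 2 * real N * t = real (2 * i) + \<alpha> \<Longrightarrow> height t < 0"
proof -
  assume a: "0 < \<alpha>" "\<alpha> < 1" "2 * real N * t = real (2 * i) + \<alpha>"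
  have "sin (pi * (real (2 * i) + \<alpha>)) = sin (pi * \<alpha>)"
  proof -
    have "pi * (real (2 * i) + \<alpha>) = 2 * real i * pi + pi * \<alpha>" by (simp add: algebra_simps)
    then show ?thesis by (simp only: sin_add sin_2npi cos_2npi mult_zero_left mult_1 add_0)
  qed
  moreover have "sin (pi * \<alpha>) > 0" using a by (intro sin_gt_zero) auto
  ultimately show ?thesis unfolding height_def a(3) by simp
qed

lemma height_over: "0 < \<beta> \<Longrightarrow> \<beta> < 1 \<Longrightarrow> 2 * real N * t = real (2 * j + 1) + \<beta> \<Longrightarrow> 0 < height t"
proof -
  assume a: "0 < \<beta>" "\<beta> < 1" "2 * real N * t = real (2 * j + 1) + \<beta>"
  have "sin (pi * (real (2 * j + 1) + \<beta>)) = - sin (pi * \<beta>)"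
  proof -
    have "pi * (real (2 * j + 1) + \<beta>) = 2 * real j * pi + (pi * \<beta> + pi)" by (simp add: algebra_simps)
    then show ?thesis by (simp only: sin_add[of "2 * real j * pi"] sin_2npi cos_2npi) simp
  qed
  moreover have "sin (pi * \<beta>) > 0" using a by (intro sin_gt_zero) auto
  ultimately show ?thesis unfolding height_def a(3) by simp
qed

text \<open>An entry (u, v, i, j) holds the ranks of the under and the over passage among all
  passages, and the numbers of the horizontal and the vertical segment. The arc leaving passage m
  has label m. The product of the two directions has the sign of
  \<open>Im (cnj p * q)\<close>.\<close>

definition grid_crossing :: "nat \<Rightarrow> nat \<times> nat \<times> nat \<times> nat \<Rightarrow> crossing" where
  "grid_crossing n = (\<lambda>(u, v, i, j). let prev = (\<lambda>m. (m + 2 * n - 1) mod (2 * n)) in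
     if (X (Suc i) - X i) * (Y (Suc j) - Y j) < 0 then Cr (prev u) v u (prev v)
     else Cr (prev u) (prev v) u v)"

text \<open>\<open>T\<close> and \<open>L\<close> form a certificate: \<open>T\<close> lists the
  passage times in increasing order, \<open>perm\<close> says that every passage belongs to exactly
  one crossing, and \<open>all\<close> that no crossing has been missed.\<close>

lemma knot_projection_grid:
  fixes L :: "(nat \<times> nat \<times> nat \<times> nat) list" and T :: "real list"
  defines "n \<equiv> length L"
  assumes n: "n > 0" and T: "sorted_wrt (<) T" "length T = 2 * n"
    and perm: "mset (map fst L @ map (fst \<circ> snd) L) = mset [0..<2 * n]"
    and L: "\<forall>(u, v, i, j) \<in> set L. i < N \<and> j < N \<and> crosses i j \<and> T ! u = under_time i j \<and> T ! v = over_time i j"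
    and all: "\<forall>i<N. \<forall>j<N. crosses i j \<longrightarrow> (i, j) \<in> set (map (snd \<circ> snd) L)"
  shows "knot_projection \<lparr>arcs = {..<2 * n}, crossings = map (grid_crossing n) L\<rparr> curve height"
proof -
  define u v where "u k = fst (L ! k)" and "v k = fst (snd (L ! k))" for k
  define I J where "I k = fst (snd (snd (L ! k)))" and "J k = snd (snd (snd (L ! k)))" for k
  define t where "t m = T ! m / (2 * real N)" for m
  have Lk: "L ! k = (u k, v k, I k, J k)" for k by (simp add: u_def v_def I_def J_def)
  have k: "I k < N" "J k < N" "crosses (I k) (J k)"
    "2 * real N * t (u k) = under_time (I k) (J k)" "2 * real N * t (v k) = over_time (I k) (J k)"
    if "k < n" for k
  proof -
    have "(u k, v k, I k, J k) \<in> set L" using that unfolding n_def Lk[symmetric] by simp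
    then show "I k < N" "J k < N" "crosses (I k) (J k)"
      "2 * real N * t (u k) = under_time (I k) (J k)" "2 * real N * t (v k) = over_time (I k) (J k)"
      using L N by (auto simp: t_def)
  qed
  let ?uv = "map fst L @ map (fst \<circ> snd) L"
  have uv: "distinct ?uv" "set ?uv = {..<2 * n}"
    using perm mset_eq_imp_distinct_iff[OF perm] mset_eq_setD[OF perm] by auto
  have nth_uv: "case_sum u v z = ?uv ! (case z of Inl k \<Rightarrow> k | Inr k \<Rightarrow> n + k)"
    if "z \<in> {..<n} <+> {..<n}" for z
    using that by (auto simp: nth_append n_def u_def v_def)
  have bij: "bij_betw (case_sum u v) ({..<n} <+> {..<n}) {..<2 * n}"
    unfolding bij_betw_def
  proof
    show "inj_on (case_sum u v) ({..<n} <+> {..<n})"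
    proof (rule inj_onI)
      fix z z' :: "nat + nat"
      assume zz: "z \<in> {..<n} <+> {..<n}" "z' \<in> {..<n} <+> {..<n}" "case_sum u v z = case_sum u v z'"
      have "(case z of Inl k \<Rightarrow> k | Inr k \<Rightarrow> n + k) = (case z' of Inl k \<Rightarrow> k | Inr k \<Rightarrow> n + k)"
        using zz(3) unfolding nth_uv[OF zz(1)] nth_uv[OF zz(2)]
        by (subst (asm) nth_eq_iff_index_eq[OF uv(1)]) (use zz(1,2) in \<open>auto simp: n_def\<close>)
      then show "z = z'" using zz(1,2) by (auto split: sum.splits)
    qed
    have "case_sum u v ` ({..<n} <+> {..<n}) = u ` {..<n} \<union> v ` {..<n}"
      by (simp add: Plus_def image_Un image_image)
    also have "\<dots> = set ?uv"
    proof -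
      have "set (map f L) = (\<lambda>k. f (L ! k)) ` {..<n}" for f :: "_ \<Rightarrow> nat"
        unfolding set_map set_conv_nth[of L] n_def by auto
      from this[of fst] this[of "fst \<circ> snd"] show ?thesis
        unfolding u_def v_def by (simp only: set_append o_def)
    qed
    finally show "case_sum u v ` ({..<n} <+> {..<n}) = {..<2 * n}" using uv(2) by simp
  qed
  have bounds: "u k < 2 * n" "v k < 2 * n" if "k < n" for k
    using bij_betwE[OF bij, rule_format, of "Inl k"] bij_betwE[OF bij, rule_format, of "Inr k"] that by auto
  have strict: "strict_mono_on {..<2 * n} t"
    unfolding t_def strict_mono_on_def using T N
    by (auto simp: sorted_wrt_iff_nth_less divide_strict_right_mono)
  have "t m \<in> {0<..<1}" if m: "m < 2 * n" for m
  proof -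
    obtain z where z: "z \<in> {..<n} <+> {..<n}" "m = case_sum u v z"
      using bij m unfolding bij_betw_def by (metis imageE lessThan_iff)
    have "0 < 2 * real N * t m \<and> 2 * real N * t m < real (2 * N)"
    proof (cases z)
      case (Inl k)
      then have "k < n" using z by auto
      have "real (I k) + 1 \<le> real N" using k(1)[OF \<open>k < n\<close>] by linarith
      then show ?thesis using z(2) Inl k(4)[OF \<open>k < n\<close>] crosses_ratios[OF k(3)[OF \<open>k < n\<close>]]
        by (simp add: under_time_def)
    next
      case (Inr k)
      then have "k < n" using z by auto
      have "real (J k) + 1 \<le> real N" using k(2)[OF \<open>k < n\<close>] by linarith
      then show ?thesis using z(2) Inr k(5)[OF \<open>k < n\<close>] crosses_ratios[OF k(3)[OF \<open>k < n\<close>]]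
        by (simp add: over_time_def)
    qed
    then show ?thesis using N by (simp add: zero_less_mult_iff)
  qed
  then have range: "t ` {..<2 * n} \<subseteq> {0<..<1}" by blast
  have double: "curve x = curve y \<longleftrightarrow> (\<exists>k<n. {x, y} = {t (u k), t (v k)})"
    if xy: "x \<in> {0..<1}" "y \<in> {0..<1}" "x < y" for x y
  proof -
    have scale: "{2 * real N * x, 2 * real N * y} = {2 * real N * t (u k), 2 * real N * t (v k)} \<longleftrightarrow>
        {x, y} = {t (u k), t (v k)}" for k
      using N by (simp add: doubleton_eq_iff)
    have "curve x = curve y \<longleftrightarrow> (\<exists>i<N. \<exists>j<N. crosses i j \<and>
        {2 * real N * x, 2 * real N * y} = {under_time i j, over_time i j})"
      using curve_eq_iff xy by simp
    also have "\<dots> \<longleftrightarrow> (\<exists>k<n. {2 * real N * x, 2 * real N * y} = {under_time (I k) (J k), over_time (I k) (J k)})"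
    proof safe
      fix i j assume ij: "i < N" "j < N" "crosses i j"
        "{2 * real N * x, 2 * real N * y} = {under_time i j, over_time i j}"
      then have "(i, j) \<in> set (map (snd \<circ> snd) L)" using all by blast
      then obtain k where "k < n" "snd (snd (L ! k)) = (i, j)"
        unfolding in_set_conv_nth n_def by auto
      then have "k < n" "i = I k" "j = J k" by (simp_all add: I_def J_def)
      then show "\<exists>k<n. {2 * real N * x, 2 * real N * y} = {under_time (I k) (J k), over_time (I k) (J k)}"
        using ij(4) by blast
    next
      fix m assume m: "m < n"
        "{2 * real N * x, 2 * real N * y} = {under_time (I m) (J m), over_time (I m) (J m)}"
      show "\<exists>i<N. \<exists>j<N. crosses i j \<and> {2 * real N * x, 2 * real N * y} = {under_time i j, over_time i j}"
        using k(1-3)[OF m(1)] m(2) by blast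
    qed
    also have "\<dots> \<longleftrightarrow> (\<exists>k<n. {x, y} = {t (u k), t (v k)})"
    proof (rule ex_cong1, rule conj_cong[OF refl])
      fix m assume "m < n"
      show "{2 * real N * x, 2 * real N * y} = {under_time (I m) (J m), over_time (I m) (J m)} \<longleftrightarrow>
        {x, y} = {t (u m), t (v m)}"
        using scale[of m] unfolding k(4)[OF \<open>m < n\<close>] k(5)[OF \<open>m < n\<close>] .
    qed
    finally show ?thesis .
  qed
  have crossing: "height (t (u k)) < height (t (v k)) \<and>
      (\<exists>p q. (curve has_vector_derivative p) (at (t (u k))) \<and>
             (curve has_vector_derivative q) (at (t (v k))) \<and> Im (cnj p * q) \<noteq> 0 \<and>
         (let prev = (\<lambda>m. (m + 2 * n - 1) mod (2 * n)); a = prev (u k); c = u k;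
              b = (if Im (cnj p * q) < 0 then v k else prev (v k));
              d = (if Im (cnj p * q) < 0 then prev (v k) else v k)
          in grid_crossing n (L ! k) = Cr a b c d))"
    if "k < n" for k
  proof -
    define p where "p = (2 * real N) *\<^sub>R (corner (Suc (2 * I k)) - corner (2 * I k))"
    define q where "q = (2 * real N) *\<^sub>R (corner (Suc (2 * J k + 1)) - corner (2 * J k + 1))"
    note kk = k[OF that]
    note r = crosses_ratios[OF kk(3)]
    have deriv: "(curve has_vector_derivative p) (at (t (u k)))" "(curve has_vector_derivative q) (at (t (v k)))"
      unfolding p_def q_def
      by (rule curve_has_vector_derivative[OF _ r(1,2)] curve_has_vector_derivative[OF _ r(3,4)];
          use kk in \<open>simp add: under_time_def over_time_def\<close>)+
    have im: "Im (cnj p * q) = (2 * real N)\<^sup>2 * ((X (Suc (I k)) - X (I k)) * (Y (Suc (J k)) - Y (J k)))"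
      by (simp add: p_def q_def corner_def power2_eq_square)
    have nz: "Im (cnj p * q) \<noteq> 0"
      unfolding im using X_Suc_neq[OF kk(1)] Y_Suc_neq[OF kk(2)] N by simp
    have neg: "Im (cnj p * q) < 0 \<longleftrightarrow> (X (Suc (I k)) - X (I k)) * (Y (Suc (J k)) - Y (J k)) < 0"
    proof -
      have "0 < (2 * real N)\<^sup>2" using N by simp
      from mult_less_cancel_left_pos[OF this, of _ 0] show ?thesis unfolding im mult_zero_right .
    qed
    have "height (t (u k)) < 0" "0 < height (t (v k))"
      using height_under[OF r(1,2)] height_over[OF r(3,4)] kk(4,5)
      unfolding under_time_def over_time_def by blast+
    then have "height (t (u k)) < height (t (v k))" by linarith
    moreover have "let prev = \<lambda>m. (m + 2 * n - 1) mod (2 * n); a = prev (u k); c = u k;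
          b = if Im (cnj p * q) < 0 then v k else prev (v k);
          d = if Im (cnj p * q) < 0 then prev (v k) else v k
        in grid_crossing n (L ! k) = Cr a b c d"
      unfolding neg Lk grid_crossing_def Let_def by simp
    ultimately show ?thesis using deriv nz by blast
  qed
  have start: "curve 0 = curve 1" "height 0 = height 1"
  proof -
    obtain M where M: "N = Suc M" using N by (cases N) auto
    have "curve 0 = Complex (X 0) (Y 0)" using curve_horizontal[of 0 0 0] N by simp
    moreover have "curve 1 = Complex (X (Suc M)) (Y M + 1 * (Y (Suc M) - Y M))"
      by (rule curve_vertical) (simp_all add: M)
    ultimately show "curve 0 = curve 1" using X_N Y_N by (simp add: M)
    have "sin (pi * (2 * real N)) = 0" using sin_2npi[of N] by (simp add: mult.commute)
    then show "height 0 = height 1" by (simp add: height_def)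
  qed
  have paths: "path curve" "path height"
    unfolding path_def curve_def height_def
    by (intro continuous_on_compose2[OF continuous_on_polyline[of UNIV]] continuous_intros; simp)+
  have max: "max 1 (2 * n) = 2 * n" using n by simp
  show ?thesis
    unfolding knot_projection_def Let_def
    apply (intro conjI)
    subgoal using paths by simp
    subgoal using start by (simp add: pathstart_def pathfinish_def)
    subgoal using paths by simp
    subgoal using start by (simp add: pathstart_def pathfinish_def)
    subgoal
      apply (rule exI[of _ t], rule exI[of _ u], rule exI[of _ v], rule exI[of _ "\<lambda>m. m"], intro conjI)
      subgoal using strict by (simp add: n_def)
      subgoal using range by (simp add: n_def)
      subgoal using max by (simp add: n_def bij_betw_def)
      subgoal using bij by (simp add: n_def)
      subgoal using double by (simp add: n_def)
      subgoal
        apply (intro allI impI)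
        subgoal premises prems for k
      proof -
        have "k < ncross \<lparr>arcs = {..<2 * n}, crossings = map (grid_crossing n) L\<rparr>" by (fact prems)
        then have "k < n" by (simp add: n_def)
        then have nth: "map (grid_crossing n) L ! k = grid_crossing n (L ! k)" by (simp add: n_def)
        from crossing[OF \<open>k < n\<close>] obtain p q where
          "height (t (u k)) < height (t (v k))"
          "(curve has_vector_derivative p) (at (t (u k)))" "(curve has_vector_derivative q) (at (t (v k)))"
          "Im (cnj p * q) \<noteq> 0"
          and c: "let prev = \<lambda>m. (m + 2 * n - 1) mod (2 * n); a = prev (u k); c = u k;
              b = if Im (cnj p * q) < 0 then v k else prev (v k);
              d = if Im (cnj p * q) < 0 then prev (v k) else v k
            in grid_crossing n (L ! k) = Cr a b c d"
          by blast
        note pq = this(1-4)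
        show ?thesis
          by (rule conjI[OF pq(1)], rule exI[of _ p], rule exI[of _ q], intro conjI pq disjI1)
            (use c nth in \<open>simp add: Let_def n_def\<close>)
      qed
      done
      done
    done
qed

end

section \<open>Grids with integer coordinates\<close>

definition cyc :: "int list \<Rightarrow> nat \<Rightarrow> real" where
  "cyc xs i = of_int (xs ! (i mod length xs))"

lemma grid_cyc:
  assumes "2 \<le> N" "distinct xs" "length xs = N" "distinct ys" "length ys = N"
  shows "grid N (cyc xs) (cyc ys)"
  by unfold_locales (use assms in \<open>auto simp: cyc_def inj_on_def nth_eq_iff_index_eq\<close>)

text \<open>An integer form of \<open>crosses\<close>, so that the search for all crossings is
  settled by evaluation.\<close>

definition crosses_int :: "int list \<Rightarrow> int list \<Rightarrow> nat \<Rightarrow> nat \<Rightarrow> bool" where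
  "crosses_int xs ys i j \<longleftrightarrow>
     (let X = (\<lambda>i. xs ! (i mod length xs)); Y = (\<lambda>i. ys ! (i mod length ys))
      in (X (Suc j) - X i) * (X (Suc j) - X (Suc i)) < 0 \<and> (Y i - Y j) * (Y i - Y (Suc j)) < 0)"

lemma crosses_int:
  "(cyc xs (Suc j) - cyc xs i) * (cyc xs (Suc j) - cyc xs (Suc i)) < 0 \<and>
   (cyc ys i - cyc ys j) * (cyc ys i - cyc ys (Suc j)) < 0 \<longleftrightarrow> crosses_int xs ys i j"
  unfolding crosses_int_def cyc_def Let_def
  by (simp only: of_int_diff[symmetric] of_int_mult[symmetric] of_int_less_0_iff)

lemma mset_eq_if_sort: "sort xs = sort ys \<Longrightarrow> mset xs = mset ys"
  by (metis mset_sort)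

section \<open>Circles of a state\<close>

definition subst :: "'a \<Rightarrow> 'a \<Rightarrow> 'a \<Rightarrow> 'a" where
  "subst x y z = (if z = y then x else z)"

text \<open>Each pair collapses its second entry to its first in all that follows; what remains is a
  representative of the class of \<open>z\<close>.\<close>

fun labels :: "('a \<times> 'a) list \<Rightarrow> 'a \<Rightarrow> 'a" where
  "labels [] z = z"
| "labels ((x, y) # ps) z = labels (map (map_prod (subst x y) (subst x y)) ps) (subst x y z)"

text \<open>A pair whose ends already agree when its turn comes closes a cycle, so this is the first
  Betti number of the graph with these edges.\<close>

fun loops :: "('a \<times> 'a) list \<Rightarrow> nat" where
  "loops [] = 0"
| "loops ((x, y) # ps) =
     (if x = y then 1 else 0) + loops (map (map_prod (subst x y) (subst x y)) ps)"

abbreviation glued :: "('a \<times> 'a) list \<Rightarrow> 'a \<Rightarrow> 'a \<Rightarrow> bool" where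
  "glued ps \<equiv> equivclp (\<lambda>x y. (x, y) \<in> set ps)"

lemma glued_Cons:
  "glued ((x, y) # ps) u v \<longleftrightarrow>
   glued (map (map_prod (subst x y) (subst x y)) ps) (subst x y u) (subst x y v)"
proof
  let ?\<sigma> = "subst x y"
  let ?big = "glued ((x, y) # ps)"
  let ?small = "glued (map (map_prod ?\<sigma> ?\<sigma>) ps)"
  have xy: "?big x y" by (intro r_into_equivclp) simp
  have \<sigma>: "?big (?\<sigma> z) z" for z
    unfolding subst_def using xy by (cases "z = y") simp_all
  have small: "?small a b \<Longrightarrow> ?big a b" for a b
  proof (induction rule: equivclp_induct)
    case (step b c)
    then obtain p q where pq: "(p, q) \<in> set ps" "b = ?\<sigma> p \<and> c = ?\<sigma> q \<or> b = ?\<sigma> q \<and> c = ?\<sigma> p"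
      by auto
    have "?big p q" using pq(1) by (intro r_into_equivclp) simp
    from equivclp_trans[OF \<sigma>[of p] equivclp_trans[OF this equivclp_sym[OF \<sigma>[of q]]]]
    have "?big (?\<sigma> p) (?\<sigma> q)" .
    with pq(2) have "?big b c" by (elim disjE conjE) (simp_all only: equivclp_sym)
    then show ?case using step.IH by (rule equivclp_trans[rotated])
  qed simp
  assume "?small (?\<sigma> u) (?\<sigma> v)"
  then show "?big u v" using small \<sigma> by (meson equivclp_sym equivclp_trans)
next
  let ?\<sigma> = "subst x y"
  let ?big = "glued ((x, y) # ps)"
  let ?small = "glued (map (map_prod ?\<sigma> ?\<sigma>) ps)"
  assume "?big u v"
  then show "?small (?\<sigma> u) (?\<sigma> v)"
  proof (induction rule: equivclp_induct)
    case (step b c)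
    have "?small (?\<sigma> b) (?\<sigma> c)" if "(b, c) \<in> set ((x, y) # ps)" for b c
    proof (cases "(b, c) = (x, y)")
      case True
      then show ?thesis by (simp add: subst_def)
    next
      case False
      then have "(?\<sigma> b, ?\<sigma> c) \<in> set (map (map_prod ?\<sigma> ?\<sigma>) ps)" using that by force
      then show ?thesis by (rule r_into_equivclp)
    qed
    then show ?case using step by (meson equivclp_sym equivclp_trans)
  qed simp
qed

lemma glued_iff_labels: "glued ps u v \<longleftrightarrow> labels ps u = labels ps v"
proof (induction ps arbitrary: u v rule: loops.induct)
  case 1
  have "u = v" if "glued [] u v" using that by (induction rule: equivclp_induct) auto
  then show ?case by auto
next
  case (2 x y ps)
  then show ?case unfolding glued_Cons by simp
qed

text \<open>This is Euler's formula: components minus independent cycles equals vertices minus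
  edges.\<close>

lemma card_labels:
  assumes "finite V" "\<forall>(x, y) \<in> set ps. x \<in> V \<and> y \<in> V"
  shows "card (labels ps ` V) + length ps = card V + loops ps"
  using assms
proof (induction ps arbitrary: V rule: loops.induct)
  case (2 x y ps)
  let ?\<sigma> = "subst x y"
  have xy: "x \<in> V" "y \<in> V" using 2(3) by auto
  have "labels ((x, y) # ps) ` V = labels (map (map_prod ?\<sigma> ?\<sigma>) ps) ` (?\<sigma> ` V)"
    by (simp add: image_image)
  moreover have "card (labels (map (map_prod ?\<sigma> ?\<sigma>) ps) ` (?\<sigma> ` V)) + length ps
      = card (?\<sigma> ` V) + loops (map (map_prod ?\<sigma> ?\<sigma>) ps)"
    using "2.IH"[of "?\<sigma> ` V"] 2(2,3) by fastforce
  moreover have "card V = card (?\<sigma> ` V) + (if x = y then 0 else 1)"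
  proof (cases "x = y")
    case True
    then have "?\<sigma> ` V = V" by (auto simp: subst_def)
    then show ?thesis using True by simp
  next
    case False
    then have "?\<sigma> ` V = V - {y}" using xy by (auto simp: subst_def image_iff)
    moreover have "card V > 0" using xy 2(2) by (auto simp: card_gt_0_iff)
    ultimately show ?thesis using False xy 2(2) by simp
  qed
  ultimately show ?case by simp
qed simp

section \<open>Smoothings of a list of crossings\<close>

fun smooth :: "bool \<Rightarrow> crossing \<Rightarrow> (nat \<times> nat) list" where
  "smooth m (Cr a b c d) = (if m then [(a, d), (b, c)] else [(a, b), (c, d)])"

fun smoothings :: "nat \<Rightarrow> nat set \<Rightarrow> crossing list \<Rightarrow> (nat \<times> nat) list" where
  "smoothings k s [] = []"
| "smoothings k s (c # cs) = smooth (k \<in> s) c @ smoothings (Suc k) s cs"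

lemma length_smoothings: "length (smoothings k s cs) = 2 * length cs"
proof (induction cs arbitrary: k)
  case (Cons c cs)
  then show ?case by (cases c) simp
qed simp

lemma set_smoothings: "set (smoothings k s cs) = (\<Union>l<length cs. set (smooth (k + l \<in> s) (cs ! l)))"
proof (induction cs arbitrary: k)
  case (Cons c cs)
  then show ?case by (simp add: lessThan_Suc_eq_insert_0 image_image)
qed simp

lemma spliced_iff: "spliced D s x y \<longleftrightarrow> (x, y) \<in> set (smoothings 0 s (crossings D))"
proof -
  have "(case c of Cr a b c d \<Rightarrow> (x, y) \<in> (if m then {(a, d), (b, c)} else {(a, b), (c, d)})) \<longleftrightarrow>
      (x, y) \<in> set (smooth m c)" for c m
    by (cases c) simp
  then show ?thesis unfolding spliced_def set_smoothings by auto
qed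

lemma circ_eq: "circ D s e = {e'. labels (smoothings 0 s (crossings D)) e = labels (smoothings 0 s (crossings D)) e'}"
  unfolding circ_def spliced_iff glued_iff_labels ..

lemma circ_eq_iff: "circ D s e = circ D s e' \<longleftrightarrow>
    labels (smoothings 0 s (crossings D)) e = labels (smoothings 0 s (crossings D)) e'"
  unfolding circ_eq by auto

definition closed_diagram :: "diagram \<Rightarrow> bool" where
  "closed_diagram D \<longleftrightarrow> crossings D \<noteq> [] \<and> arcs D = {..<2 * ncross D} \<and>
     (\<forall>c\<in>set (crossings D). case c of Cr a b c d \<Rightarrow> {a, b, c, d} \<subseteq> arcs D)"

text \<open>In every state 2n arcs are joined by 2n gluings. The Euler characteristic of this graph
  is 0, so counting circles amounts to counting closed cycles.\<close>

lemma card_circles: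
  assumes "closed_diagram D"
  shows "card (circles D s) = loops (smoothings 0 s (crossings D))"
proof -
  let ?f = "labels (smoothings 0 s (crossings D))"
  have "circles D s = (\<lambda>l. {e'. l = ?f e'}) ` (?f ` arcs D)"
    unfolding circles_def circ_eq image_image ..
  moreover have "inj_on (\<lambda>l. {e'. l = ?f e'}) (?f ` arcs D)"
    by (rule inj_onI) blast
  ultimately have "card (circles D s) = card (?f ` arcs D)" by (simp add: card_image)
  moreover have "\<forall>(x, y) \<in> set (smoothings 0 s (crossings D)). x \<in> arcs D \<and> y \<in> arcs D"
  proof clarify
    fix x y assume "(x, y) \<in> set (smoothings 0 s (crossings D))"
    then obtain l where l: "l < ncross D" "(x, y) \<in> set (smooth (l \<in> s) (crossings D ! l))"
      unfolding set_smoothings by auto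
    obtain a b c d where cr: "crossings D ! l = Cr a b c d" by (cases "crossings D ! l")
    then have "{a, b, c, d} \<subseteq> arcs D"
      using assms nth_mem[OF l(1)] unfolding closed_diagram_def by fastforce
    then show "x \<in> arcs D \<and> y \<in> arcs D"
      using l(2) unfolding cr by (auto split: if_splits)
  qed
  ultimately show ?thesis
    using card_labels[of "arcs D" "smoothings 0 s (crossings D)"] assms
    by (simp add: closed_diagram_def length_smoothings)
qed

section \<open>The Kauffman bracket as a state sum\<close>

fun padd :: "int list \<Rightarrow> int list \<Rightarrow> int list" where
  "padd [] q = q"
| "padd (a # p) [] = a # p"
| "padd (a # p) (b # q) = (a + b) # padd p q"

fun peval :: "int list \<Rightarrow> 'a::comm_ring_1 \<Rightarrow> 'a" where
  "peval [] y = 0"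
| "peval (a # p) y = of_int a + y * peval p y"

lemma peval_padd: "peval (padd p q) y = peval p y + peval q y"
  by (induction p q rule: padd.induct) (simp_all add: algebra_simps)

lemma peval_uminus: "peval (map uminus p) y = - peval p y"
  by (induction p) (simp_all add: algebra_simps)

lemma peval_replicate: "peval (replicate k 0 @ p) y = y ^ k * peval p y"
  by (induction k) (simp_all add: algebra_simps)

fun rename :: "(nat \<Rightarrow> nat) \<Rightarrow> crossing \<Rightarrow> crossing" where
  "rename f (Cr a b c d) = Cr (f a) (f b) (f c) (f d)"

lemma smooth_rename: "smooth m (rename f c) = map (map_prod f f) (smooth m c)"
  by (cases c) simp

text \<open>This lets an identification of arcs be carried out on crossings that are still
  unresolved.\<close>

lemma smoothings_rename: "smoothings k s (map (rename f) cs) = map (map_prod f f) (smoothings k s cs)"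
  by (induction cs arbitrary: k) (simp_all add: smooth_rename)

lemma smoothings_cong: "(\<And>l. k \<le> l \<Longrightarrow> l \<in> s \<longleftrightarrow> l \<in> s') \<Longrightarrow> smoothings k s cs = smoothings k s' cs"
  by (induction cs arbitrary: k) auto

text \<open>With \<open>y = A\<^sup>-\<^sup>2\<close> and \<open>\<delta> = - A\<^sup>2 - A\<^sup>-\<^sup>2\<close>, every gluing contributes a factor \<open>y\<close>, and also
  \<open>\<delta>\<close> if it closes a circle; this makes all coefficients polynomial in \<open>y\<close>, as
  \<open>y \<delta> = - 1 - y\<^sup>2\<close>.\<close>

function (sequential) state_sum :: "(nat \<times> nat) list \<Rightarrow> crossing list \<Rightarrow> int list" where
  "state_sum [] [] = [1]"
| "state_sum [] (c # cs) = padd (state_sum (smooth False c) cs) (0 # state_sum (smooth True c) cs)"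
| "state_sum ((x, y) # ps) cs =
     (if x = y then let p = state_sum ps cs in map uminus (padd p (0 # 0 # p))
      else 0 # state_sum (map (map_prod (subst x y) (subst x y)) ps) (map (rename (subst x y)) cs))"
  by pat_completeness auto
text \<open>Resolving a crossing lengthens the list of gluings, hence the lexicographic order with
  the crossings first.\<close>

termination by (relation "measures [length \<circ> snd, length \<circ> fst]") auto

lemma sum_Pow_insert:
  assumes "finite S" "k \<notin> S"
  shows "(\<Sum>s\<in>Pow (insert k S). F s) = (\<Sum>s\<in>Pow S. F s) + (\<Sum>s\<in>Pow S. F (insert k s))"
proof -
  have "inj_on (insert k) (Pow S)" using assms(2) by (auto simp: inj_on_def)
  moreover have "Pow S \<inter> insert k ` Pow S = {}" using assms(2) by auto
  ultimately show ?thesis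
    using assms(1) by (simp add: Pow_insert sum.union_disjoint sum.reindex)
qed

text \<open>The induction needs pending gluings \<open>ps\<close> and an offset \<open>k\<close>,
  because the crossings left after the first one keep their indices in the state.\<close>

lemma peval_state_sum:
  fixes y \<delta> :: "'a::comm_ring_1"
  assumes y: "y * \<delta> = - 1 - y\<^sup>2"
  shows "peval (state_sum ps cs) y =
    (\<Sum>s\<in>Pow {k..<k + length cs}.
       y ^ card s * (y ^ length (ps @ smoothings k s cs) * \<delta> ^ loops (ps @ smoothings k s cs)))"
proof (induction ps cs arbitrary: k rule: state_sum.induct)
  case 1
  show ?case by simp
next
  case (2 c cs)
  let ?F = "\<lambda>ps k s. y ^ length (ps @ smoothings k s cs) * \<delta> ^ loops (ps @ smoothings k s cs)"
  have set: "{k..<k + length (c # cs)} = insert k {Suc k..<Suc k + length cs}" by auto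
  have eq: "smoothings (Suc k) (insert k s) cs = smoothings (Suc k) s cs" for s
    by (rule smoothings_cong) auto
  have "(\<Sum>s\<in>Pow {Suc k..<Suc k + length cs}. y ^ card s * (y ^ length ([] @ smoothings k s (c # cs)) *
      \<delta> ^ loops ([] @ smoothings k s (c # cs)))) = peval (state_sum (smooth False c) cs) y"
    unfolding 2(1)[of "Suc k"]
  proof (rule sum.cong[OF refl])
    fix s assume "s \<in> Pow {Suc k..<Suc k + length cs}"
    then have "k \<notin> s" by auto
    then show "y ^ card s * (y ^ length ([] @ smoothings k s (c # cs)) *
      \<delta> ^ loops ([] @ smoothings k s (c # cs))) = y ^ card s * ?F (smooth False c) (Suc k) s" by simp
  qed
  moreover have "(\<Sum>s\<in>Pow {Suc k..<Suc k + length cs}. y ^ card (insert k s) *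
      (y ^ length ([] @ smoothings k (insert k s) (c # cs)) *
      \<delta> ^ loops ([] @ smoothings k (insert k s) (c # cs)))) = y * peval (state_sum (smooth True c) cs) y"
    unfolding 2(2)[of "Suc k"] sum_distrib_left
  proof (rule sum.cong[OF refl])
    fix s assume s: "s \<in> Pow {Suc k..<Suc k + length cs}"
    then have "card (insert k s) = Suc (card s)"
      using finite_subset[of s "{Suc k..<Suc k + length cs}"] by (subst card_insert_disjoint) auto
    then show "y ^ card (insert k s) * (y ^ length ([] @ smoothings k (insert k s) (c # cs)) *
      \<delta> ^ loops ([] @ smoothings k (insert k s) (c # cs))) =
      y * (y ^ card s * ?F (smooth True c) (Suc k) s)" by (simp add: eq mult.assoc)
  qed
  ultimately show ?case
    unfolding set by (subst sum_Pow_insert) (simp_all add: peval_padd)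
next
  case (3 x z ps cs)
  show ?case
  proof (cases "x = z")
    case True
    then have id: "map_prod (subst x z) (subst x z) = id"
      by (auto simp: subst_def fun_eq_iff)
    have "peval (state_sum ((x, z) # ps) cs) y = y * \<delta> * peval (state_sum ps cs) y"
      unfolding y using True
      by (simp add: Let_def peval_uminus peval_padd algebra_simps power2_eq_square)
    also have "\<dots> = (\<Sum>s\<in>Pow {k..<k + length cs}. y * \<delta> * (y ^ card s *
        (y ^ length (ps @ smoothings k s cs) * \<delta> ^ loops (ps @ smoothings k s cs))))"
      unfolding 3(1)[OF True, of k] sum_distrib_left ..
    finally show ?thesis
      using True id by (simp add: mult_ac)
  next
    case False
    then have "peval (state_sum ((x, z) # ps) cs) y = y * peval (state_sum
        (map (map_prod (subst x z) (subst x z)) ps) (map (rename (subst x z)) cs)) y" by simp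
    also have "\<dots> = (\<Sum>s\<in>Pow {k..<k + length cs}. y * (y ^ card s *
        (y ^ length (ps @ smoothings k s cs) * \<delta> ^ loops ((x, z) # ps @ smoothings k s cs))))"
      unfolding 3(2)[OF False, of k] sum_distrib_left using False by (simp add: smoothings_rename)
    finally show ?thesis by (simp add: mult_ac)
  qed
qed

lemma a_minus_b_eq: "s \<in> states D \<Longrightarrow> a_minus_b D s = int (ncross D) - 2 * int (card s)"
  unfolding a_minus_b_def states_def
  using card_mono[of "{..<ncross D}" s] finite_subset[of s "{..<ncross D}"]
  by (subst card_Diff_subset) (auto simp: of_nat_diff)

text \<open>The factor \<delta> makes up for the exponent |s| - 1. The exponent 5n is n from a - b =
  n - 2b plus 4n to undo the factors y of the 2n gluings.\<close>

lemma kauffman_bracket_state_sum: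
  fixes \<delta> :: "int fls"
  defines "\<delta> \<equiv> - fls_X_intpow 2 - fls_X_intpow (- 2)"
  assumes D: "closed_diagram D"
  shows "\<delta> * kauffman_bracket D =
    fls_X_intpow (5 * int (ncross D)) * peval (state_sum [] (crossings D)) (fls_X_intpow (- 2))"
proof -
  define X :: "int \<Rightarrow> int fls" where "X i = fls_X_intpow i" for i
  have X_mult: "X i * X j = X (i + j)" and X_power: "X i ^ m = X (int m * i)" and X_0: "X 0 = 1" for i j m
    unfolding X_def by (simp_all only: fls_X_intpow_times_fls_X_intpow fls_X_intpow_power of_nat_id) simp
  let ?n = "ncross D" and ?y = "X (- 2)" and ?cs = "crossings D"
  have \<delta>: "\<delta> = - X 2 - X (- 2)" unfolding \<delta>_def X_def ..
  have y: "?y * \<delta> = - 1 - ?y\<^sup>2"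
    unfolding \<delta> by (simp add: right_diff_distrib X_mult X_0 power2_eq_square)
  have term_eq: "\<delta> * (X (a_minus_b D s) * \<delta> ^ (card (circles D s) - 1)) =
      X (5 * int ?n) * (?y ^ card s * (?y ^ length ([] @ smoothings 0 s ?cs) *
        \<delta> ^ loops ([] @ smoothings 0 s ?cs)))" if "s \<in> Pow {0..<0 + ?n}" for s
  proof -
    have "finite (circles D s)" "circles D s \<noteq> {}"
      using D unfolding closed_diagram_def circles_def by (auto simp: lessThan_empty_iff)
    then have pos: "card (circles D s) > 0" by (simp add: card_gt_0_iff)
    have "\<delta> * \<delta> ^ (card (circles D s) - 1) = \<delta> ^ loops (smoothings 0 s ?cs)"
      unfolding card_circles[OF D, symmetric] power_Suc[symmetric] using pos by simp
    then have "\<delta> * (X (a_minus_b D s) * \<delta> ^ (card (circles D s) - 1)) =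
        X (a_minus_b D s) * \<delta> ^ loops (smoothings 0 s ?cs)"
      by (metis mult.left_commute)
    moreover have "a_minus_b D s = int ?n - 2 * int (card s)"
      using that by (intro a_minus_b_eq) (simp add: states_def atLeast0LessThan)
    moreover have "X (5 * int ?n) * (?y ^ card s * ?y ^ (2 * ?n)) = X (int ?n - 2 * int (card s))"
      unfolding X_power X_mult by (simp add: algebra_simps)
    ultimately show ?thesis
      by (simp add: length_smoothings mult.assoc[symmetric])
  qed
  have "\<delta> * kauffman_bracket D = (\<Sum>s\<in>Pow {0..<0 + ?n}.
      \<delta> * (X (a_minus_b D s) * \<delta> ^ (card (circles D s) - 1)))"
    unfolding kauffman_bracket_def states_def X_def[symmetric] \<delta>[symmetric] sum_distrib_left
    by (simp add: atLeast0LessThan)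
  also have "\<dots> = X (5 * int ?n) * peval (state_sum [] ?cs) ?y"
    unfolding peval_state_sum[OF y, of "[]" ?cs 0] sum_distrib_left
    by (rule sum.cong[OF refl term_eq])
  finally show ?thesis unfolding X_def .
qed

lemma same_kauffman_bracket:
  assumes D: "closed_diagram D" "closed_diagram D'"
    and sums: "state_sum [] (crossings D) = replicate k 0 @ p" "state_sum [] (crossings D') = replicate k' 0 @ p"
    and shift: "5 * int (ncross D) - 2 * int k = 5 * int (ncross D') - 2 * int k'"
  shows "kauffman_bracket D = kauffman_bracket D'"
proof -
  let ?\<delta> = "- fls_X_intpow 2 - fls_X_intpow (- 2) :: int fls"
  have eq: "fls_X_intpow (5 * int m) * (fls_X_intpow (- 2) ^ l * q) = fls_X_intpow (5 * int m - 2 * int l) * q"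
    for m l and q :: "int fls"
    unfolding fls_X_intpow_power mult.assoc[symmetric] fls_X_intpow_times_fls_X_intpow
    by (simp add: algebra_simps)
  have "?\<delta> * kauffman_bracket D = ?\<delta> * kauffman_bracket D'"
    unfolding kauffman_bracket_state_sum[OF D(1)] kauffman_bracket_state_sum[OF D(2)]
      sums peval_replicate eq shift ..
  moreover have "fls_nth ?\<delta> 2 \<noteq> 0" by simp
  then have "?\<delta> \<noteq> 0" by (metis fls_zero_nth)
  ultimately show ?thesis by (rule iffD1[OF mult_left_cancel, rotated])
qed

section \<open>Nontrivial homology classes at the Seifert state\<close>

lemma framed_homology_carrier:
  "carrier (framed_homology D i j) =
     (\<lambda>a. (\<lambda>h. h + a) ` (framed_boundary D ` carrier (free_Abelian_group (framed_basis D (1 - i) j)))) `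
       {a. Poly_Mapping.keys a \<subseteq> framed_basis D i j \<and> framed_boundary D a = 0}"
  by (auto simp: framed_homology_def homology_def framed_complex_def FactGroup_def RCOSETS_def
      r_coset_def kernel_def free_Abelian_group_def)

lemma framed_homology_trivial:
  assumes "framed_basis D i j = {}" "A \<in> carrier (framed_homology D i j)" "B \<in> carrier (framed_homology D i j)"
  shows "A = B"
  using assms unfolding framed_homology_carrier by auto

lemma framed_homology_nontrivial:
  assumes "Poly_Mapping.keys z \<subseteq> framed_basis D i j" "framed_boundary D z = 0"
    and "\<And>x. framed_boundary D x \<noteq> z"
  obtains A B where "A \<in> carrier (framed_homology D i j)" "B \<in> carrier (framed_homology D i j)" "A \<noteq> B"
proof
  let ?coset = "\<lambda>a. (\<lambda>h. h + a) ` (framed_boundary D ` carrier (free_Abelian_group (framed_basis D (1 - i) j)))"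
  have zero: "framed_boundary D 0 = 0" by (simp add: framed_boundary_def)
  show "?coset z \<in> carrier (framed_homology D i j)" "?coset 0 \<in> carrier (framed_homology D i j)"
    unfolding framed_homology_carrier
    by (rule image_eqI[where x = z], use assms in simp_all)
      (rule image_eqI[where x = 0], use zero in simp_all)
  have "0 \<in> framed_boundary D ` carrier (free_Abelian_group (framed_basis D (1 - i) j))"
    using zero by (auto simp: image_iff free_Abelian_group_def intro!: exI[of _ 0])
  then have "z \<in> ?coset z" by force
  moreover have "z \<notin> ?coset 0" using assms(3) by auto
  ultimately show "?coset z \<noteq> ?coset 0" by blast
qed

text \<open>Only sizes are compared: without chains in degree \<open>j\<close> the second homology
  group has one element there.\<close>

lemma not_pair_iso:
  assumes "framed_basis D' 0 j = {}"
    and "A \<in> carrier (framed_homology D 0 j)" "B \<in> carrier (framed_homology D 0 j)" "A \<noteq> B"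
  shows "\<not> pair_iso (framed_homology D) (framed_homology D')"
proof
  assume "pair_iso (framed_homology D) (framed_homology D')"
  then obtain f where "f \<in> iso (framed_homology D 0 j) (framed_homology D' 0 j)"
    unfolding pair_iso_def graded_iso_def is_iso_def by blast
  then have "bij_betw f (carrier (framed_homology D 0 j)) (carrier (framed_homology D' 0 j))"
    by (simp add: iso_def)
  then have "f A \<in> carrier (framed_homology D' 0 j)" "f B \<in> carrier (framed_homology D' 0 j)" "f A \<noteq> f B"
    using assms(2-4) by (auto simp: bij_betw_def inj_on_def)
  then show False using framed_homology_trivial[OF assms(1)] by blast
qed

lemma edeg_le:
  assumes "s \<in> states D"
  shows "edeg D (s, \<epsilon>) \<le> 2 * int (card (circles D s)) + (int (ncross D) - 2 * int (card s))"
proof -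
  have "wdeg w \<le> 2" for w by (cases w) simp_all
  then have "(\<Sum>Z\<in>circles D s. wdeg (\<epsilon> Z)) \<le> (\<Sum>Z\<in>circles D s. 2)" by (intro sum_mono)
  then show ?thesis using assms by (simp add: edeg_def a_minus_b_eq)
qed

lemma circ_self: "e \<in> circ D s e"
  by (simp add: circ_def)

lemma circles_eqI: "Z \<in> circles D s \<Longrightarrow> e \<in> Z \<Longrightarrow> Z = circ D s e"
  unfolding circles_def circ_eq by auto

lemma framed_boundary_frag_of:
  "framed_boundary D (frag_of (s, \<epsilon>)) =
    (\<Sum>k\<in>{..<ncross D} - s. frag_cmul ((- 1) ^ card {l\<in>s. l < k}) (edge_map D s k \<epsilon>))"
  by (simp add: framed_boundary_def)

text \<open>Think of \<open>s\<close> as the Seifert state: the crossings outside \<open>s\<close> are the positive ones, and they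
  join circles of opposite sign \<open>\<sigma>\<close>, never \<open>c\<close>; the crossings in \<open>s\<close> are the negative ones, and each
  of them joins \<open>c\<close> to \<open>u\<close> or to \<open>v\<close>. In \<open>cycle\<close>, the circles \<open>c\<close> and \<open>w\<close> carry \<open>w\<^sub>-\<close> and the signs
  cancel under every merge; \<open>cocycle\<close> vanishes on every comultiplication.\<close>

locale seifert_class =
  fixes D :: diagram and s :: "nat set" and c u v :: "nat set" and \<sigma> :: "nat set \<Rightarrow> int"
  assumes D: "closed_diagram D" and s: "s \<in> states D"
    and cuv: "c \<in> circles D s" "u \<in> circles D s" "v \<in> circles D s" "c \<noteq> u" "c \<noteq> v" "u \<noteq> v"
    and sign: "\<sigma> u = 1" "\<sigma> v = 1"
    and merges: "\<And>k p q r t. k < ncross D \<Longrightarrow> k \<notin> s \<Longrightarrow> crossings D ! k = Cr p q r t \<Longrightarrow>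
      circ D s p \<noteq> circ D s r \<and> c \<noteq> circ D s p \<and> c \<noteq> circ D s r \<and>
      \<sigma> (circ D s p) + \<sigma> (circ D s r) = 0 \<and> circ D (insert k s) p = circ D (insert k s) r"
    and splits: "\<And>k p q r t. k \<in> s \<Longrightarrow> crossings D ! k = Cr p q r t \<Longrightarrow>
      circ D (s - {k}) p = circ D (s - {k}) r \<and> {circ D s p, circ D s r} \<in> {{c, u}, {c, v}}"
begin

definition gen :: "nat set set \<Rightarrow> nat set \<Rightarrow> wgen" where
  "gen M = (\<lambda>Z\<in>circles D s. if Z \<in> M then Wminus else Wplus)"

definition cycle :: "enhanced \<Rightarrow>\<^sub>0 int" where
  "cycle = (\<Sum>w\<in>circles D s - {c}. frag_cmul (\<sigma> w) (frag_of (s, gen {c, w})))"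

definition cocycle :: "(enhanced \<Rightarrow>\<^sub>0 int) \<Rightarrow> int" where
  "cocycle x = Poly_Mapping.lookup x (s, gen {u, v}) - Poly_Mapping.lookup x (s, gen {c, u})
     - Poly_Mapping.lookup x (s, gen {c, v})"

lemma finite_circles: "finite (circles D s)"
  using D unfolding circles_def closed_diagram_def by simp

lemma crossing_arcs:
  assumes "k < ncross D" "crossings D ! k = Cr p q r t"
  shows "circ D s' p \<in> circles D s'" "circ D s' r \<in> circles D s'"
proof -
  have "{p, q, r, t} \<subseteq> arcs D"
    using D nth_mem[OF assms(1)] assms(2) unfolding closed_diagram_def by fastforce
  then show "circ D s' p \<in> circles D s'" "circ D s' r \<in> circles D s'" unfolding circles_def by auto
qed

lemma gen_eq_iff: "M \<subseteq> circles D s \<Longrightarrow> M' \<subseteq> circles D s \<Longrightarrow> gen M = gen M' \<longleftrightarrow> M = M'"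
proof
  assume M: "M \<subseteq> circles D s" "M' \<subseteq> circles D s" and eq: "gen M = gen M'"
  have "Z \<in> M \<longleftrightarrow> Z \<in> M'" if "Z \<in> circles D s" for Z
    using fun_cong[OF eq, of Z] that by (simp add: gen_def split: if_splits)
  then show "M = M'" using M by blast
qed simp

lemma cocycle_gen:
  "M \<subseteq> circles D s \<Longrightarrow> cocycle (frag_of (s, gen M)) =
    (if M = {u, v} then 1 else 0) - (if M = {c, u} then 1 else 0) - (if M = {c, v} then 1 else 0)"
  using cuv by (simp add: cocycle_def gen_eq_iff)

lemma cocycle_linear:
  "cocycle 0 = 0" "cocycle (x + y) = cocycle x + cocycle y" "cocycle (frag_cmul a x) = a * cocycle x"
  by (simp_all add: cocycle_def lookup_add algebra_simps)

lemma cocycle_sum: "cocycle (\<Sum>i\<in>I. f i) = (\<Sum>i\<in>I. cocycle (f i))"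
  by (induction I rule: infinite_finite_induct) (simp_all add: cocycle_linear)

lemma cocycle_other_state: "s' \<noteq> s \<Longrightarrow> cocycle (frag_extend (\<lambda>x. frag_of (s', f x)) y) = 0"
  unfolding frag_extend_def
  by (simp add: cocycle_sum cocycle_linear) (simp add: cocycle_def)

text \<open>Only edges ending in \<open>s\<close> matter, and these split a circle into c and one of
  u, v, over fixed marks elsewhere. A split w_- yields a sum of two terms with w_- on c or on the
  other part, so the functional must take opposite values there; the value 1 on {u, v} thus forces
  -1 on {c, u} and {c, v}. A split w_+ leaves both parts unmarked, while each of the three
  supporting pairs contains c or that other part.\<close>

lemma cocycle_edge_map:
  assumes "k < ncross D" "k \<notin> s'"
  shows "cocycle (edge_map D s' k \<epsilon>) = 0"
proof (cases "insert k s' = s")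
  case False
  obtain p q r t where cr: "crossings D ! k = Cr p q r t" by (cases "crossings D ! k")
  show ?thesis
    unfolding edge_map_def Let_def cr crossing.case case_prod_unfold
    by (simp only: split: if_split) (intro conjI impI cocycle_other_state[OF False])
next
  case True
  then have s': "s' = s - {k}" "k \<in> s" using assms(2) by auto
  obtain p q r t where cr: "crossings D ! k = Cr p q r t" by (cases "crossings D ! k")
  let ?A = "circ D s p" and ?B = "circ D s r"
  note split = splits[OF s'(2) cr]
  have AB: "?A \<in> circles D s" "?B \<in> circles D s" "?A \<noteq> ?B"
    using crossing_arcs[OF assms(1) cr] split cuv by (auto simp: doubleton_eq_iff)
  define R where "R = {Z \<in> circles D s - {?A, ?B}. \<epsilon> Z = Wminus}"
  have wgen: "w \<noteq> Wminus \<Longrightarrow> w = Wplus" for w by (cases w) simp_all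
  define G where "G x y = (\<lambda>Z\<in>circles D s. if Z = ?A then x else if Z = ?B then y else \<epsilon> Z)" for x y
  have G: "G x y = gen ((if x = Wminus then {?A} else {}) \<union> (if y = Wminus then {?B} else {}) \<union> R)" for x y
    unfolding G_def gen_def R_def using AB wgen by (intro restrict_ext) auto
  have R: "R \<subseteq> circles D s" "?A \<notin> R" "?B \<notin> R" by (auto simp: R_def)
  have AB_cases: "?A = c \<and> (?B = u \<or> ?B = v) \<or> ?B = c \<and> (?A = u \<or> ?A = v)"
    using split by (auto simp: doubleton_eq_iff)
  have "circ D s' p = circ D s' r" using split s'(1) by simp
  then have edge: "edge_map D s' k \<epsilon> = frag_extend (\<lambda>(x, y). frag_of (s, G x y)) (\<Delta>bar (\<epsilon> (circ D s' p)))"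
    unfolding edge_map_def Let_def cr crossing.case True G_def by simp
  show ?thesis
  proof (cases "\<epsilon> (circ D s' p)")
    case Wplus
    have "c \<notin> R \<and> (u \<notin> R \<or> v \<notin> R)" using AB_cases R by (elim disjE conjE) simp_all
    then have "R \<noteq> {u, v}" "R \<noteq> {c, u}" "R \<noteq> {c, v}" by blast+
    then have "cocycle (frag_of (s, gen R)) = 0" by (simp add: cocycle_gen[OF R(1)])
    then show ?thesis unfolding edge Wplus by (simp add: G)
  next
    case Wminus
    have "cocycle (frag_of (s, gen (insert ?A R))) + cocycle (frag_of (s, gen (insert ?B R))) = 0"
    proof -
      have *: "cocycle (frag_of (s, gen (insert c R))) + cocycle (frag_of (s, gen (insert w R))) = 0"
        if "w = u \<or> w = v" "c \<notin> R" "w \<notin> R" for w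
      proof -
        \<comment> \<open>Both terms lie in the support only for \<open>R\<close> = {w'}, where they
          are {c, w'} and {w, w'} with values -1 and 1.\<close>
        define w' where "w' = (if w = u then v else u)"
        have w': "{u, v} = {w, w'}" "w \<noteq> w'" "c \<noteq> w" "c \<noteq> w'" using that(1) cuv by (auto simp: w'_def)
        have sub: "insert c R \<subseteq> circles D s" "insert w R \<subseteq> circles D s" using R(1) cuv that(1) by auto
        have eqs: "insert c R = {c, w'} \<longleftrightarrow> R = {w'}" "insert w R = {w, w'} \<longleftrightarrow> R = {w'}"
          using that(2,3) w'(2,4) by (simp_all add: insert_ident)
        note facts = that(2,3) w'(2-4)
        have neq_a0: "insert c R \<noteq> {w, w'}"
          by (rule notI, drule eqset_imp_iff[of _ _ c]) (use facts in simp)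
        have neq_a1: "insert c R \<noteq> {c, w}"
          by (rule notI, drule eqset_imp_iff[of _ _ w]) (use facts in simp)
        have neq_b0: "insert w R \<noteq> {c, w}"
          by (rule notI, drule eqset_imp_iff[of _ _ c]) (use facts in simp)
        have neq_b1: "insert w R \<noteq> {c, w'}"
          by (rule notI, drule eqset_imp_iff[of _ _ w]) (use facts in simp)
        have ww': "w = u \<and> w' = v \<or> w = v \<and> w' = u" using that(1) by (auto simp: w'_def)
        have val: "cocycle (frag_of (s, gen M)) = (if M = {w, w'} then 1 else 0) - (if M = {c, w} then 1 else 0)
            - (if M = {c, w'} then 1 else 0)" if M: "M \<subseteq> circles D s" for M
          using ww' unfolding cocycle_gen[OF M] by (elim disjE conjE) (simp_all add: insert_commute)
        show ?thesis unfolding val[OF sub(1)] val[OF sub(2)]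
          by (simp add: eqs neq_a0 neq_a1 neq_b0 neq_b1)
      qed
      show ?thesis using AB_cases
      proof (elim disjE conjE)
        assume "?A = c" "?B = u" then show ?thesis using *[of u] R by simp
      next
        assume "?A = c" "?B = v" then show ?thesis using *[of v] R by simp
      next
        assume "?B = c" "?A = u" then show ?thesis using *[of u] R by (simp add: add.commute)
      next
        assume "?B = c" "?A = v" then show ?thesis using *[of v] R by (simp add: add.commute)
      qed
    qed
    then show ?thesis unfolding edge Wminus by (simp add: G frag_extend_add cocycle_linear add.commute)
  qed
qed

lemma cocycle_boundary: "cocycle (framed_boundary D x) = 0"
proof -
  have "cocycle (framed_boundary D (frag_of e)) = 0" for e
  proof (cases e)
    case (Pair s' \<epsilon>)
    then show ?thesis
      unfolding Pair framed_boundary_frag_of cocycle_sum cocycle_linear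
      by (intro sum.neutral) (auto simp: cocycle_edge_map)
  qed
  then show ?thesis
    unfolding framed_boundary_def frag_extend_def[of _ x] cocycle_sum cocycle_linear by simp
qed

text \<open>Only the summands w = u and w = v meet the support of the functional; as both signs are
  1, the two values -1 add up instead of cancelling.\<close>

lemma cocycle_cycle: "cocycle cycle = - 2"
proof -
  have "cocycle cycle = (\<Sum>w\<in>circles D s - {c}. \<sigma> w * ((if w = u then - 1 else 0) + (if w = v then - 1 else 0)))"
    unfolding cycle_def cocycle_sum cocycle_linear
  proof (rule sum.cong[OF refl])
    fix w assume w: "w \<in> circles D s - {c}"
    have "{c, w} \<noteq> {u, v}" "{c, w} = {c, u} \<longleftrightarrow> w = u" "{c, w} = {c, v} \<longleftrightarrow> w = v"
      using w cuv by (auto simp: doubleton_eq_iff)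
    then show "\<sigma> w * cocycle (frag_of (s, gen {c, w})) =
        \<sigma> w * ((if w = u then - 1 else 0) + (if w = v then - 1 else 0))"
      using w cuv by (simp add: cocycle_gen)
  qed
  also have "\<dots> = - \<sigma> u - \<sigma> v"
    using cuv finite_circles
    by (simp add: distrib_left sum.distrib if_distrib[of "\<lambda>x. _ * x"] sum.delta cong: if_cong)
  finally show ?thesis using sign by simp
qed

text \<open>At a merge of A and B, a summand with w different from both multiplies w_+ by w_+ and
  vanishes. The summands w = A and w = B both put w_+ on the merged circle, and their coefficients
  are opposite.\<close>

lemma boundary_cycle: "framed_boundary D cycle = 0"
proof -
  let ?\<epsilon> = "\<lambda>w. gen {c, w}"
  have edge: "(\<Sum>w\<in>circles D s - {c}. frag_cmul (\<sigma> w) (edge_map D s k (?\<epsilon> w))) = 0"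
    if k: "k < ncross D" "k \<notin> s" for k
  proof -
    obtain p q r t where cr: "crossings D ! k = Cr p q r t" by (cases "crossings D ! k")
    let ?s = "insert k s" and ?A = "circ D s p" and ?B = "circ D s r"
    note merge = merges[OF k cr]
    note AB = crossing_arcs[OF k(1) cr, of s]
    let ?g = "\<lambda>w x. \<lambda>Z\<in>circles D ?s. if Z = circ D ?s p then x else ?\<epsilon> w Z"
    have em: "edge_map D s k (?\<epsilon> w) = frag_extend (\<lambda>x. frag_of (?s, ?g w x)) (mbar (?\<epsilon> w ?A) (?\<epsilon> w ?B))" for w
      unfolding edge_map_def Let_def cr crossing.case using merge by simp
    \<comment> \<open>The two assignments could differ only at the arc sets A and B. A circle of the
      new state equal to one of them contains p or r, so it is the merged circle, whose value is
      overwritten.\<close>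
    have "?g ?A Wplus = ?g ?B Wplus"
    proof (rule restrict_ext)
      fix Z assume Z: "Z \<in> circles D ?s"
      have "Z = circ D ?s p" if "Z = ?A \<or> Z = ?B"
        using that circles_eqI[OF Z, of p] circles_eqI[OF Z, of r] circ_self[of p D s] circ_self[of r D s] merge
        by auto
      then show "(if Z = circ D ?s p then Wplus else ?\<epsilon> ?A Z) = (if Z = circ D ?s p then Wplus else ?\<epsilon> ?B Z)"
        using Z by (cases "Z = ?A \<or> Z = ?B") (simp_all add: gen_def)
    qed
    moreover have "edge_map D s k (?\<epsilon> ?A) = frag_of (?s, ?g ?A Wplus)" "edge_map D s k (?\<epsilon> ?B) = frag_of (?s, ?g ?B Wplus)"
      unfolding em using merge AB by (auto simp: gen_def)
    ultimately have eq: "edge_map D s k (?\<epsilon> ?A) = edge_map D s k (?\<epsilon> ?B)" by simp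
    have "edge_map D s k (?\<epsilon> w) = 0" if "w \<noteq> ?A" "w \<noteq> ?B" for w
      unfolding em using that merge AB by (auto simp: gen_def)
    then have "(\<Sum>w\<in>circles D s - {c}. frag_cmul (\<sigma> w) (edge_map D s k (?\<epsilon> w))) =
        (\<Sum>w\<in>{?A, ?B}. frag_cmul (\<sigma> w) (edge_map D s k (?\<epsilon> w)))"
      using AB merge finite_circles by (intro sum.mono_neutral_right) auto
    also have "\<dots> = frag_cmul (\<sigma> ?A) (edge_map D s k (?\<epsilon> ?B)) + frag_cmul (\<sigma> ?B) (edge_map D s k (?\<epsilon> ?B))"
      using merge eq by simp
    also have "\<dots> = frag_cmul (\<sigma> ?A + \<sigma> ?B) (edge_map D s k (?\<epsilon> ?B))"
      by (simp only: frag_cmul_distrib)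
    finally show ?thesis using merge by simp
  qed
  have "framed_boundary D cycle = (\<Sum>w\<in>circles D s - {c}. frag_cmul (\<sigma> w) (framed_boundary D (frag_of (s, ?\<epsilon> w))))"
    unfolding cycle_def framed_boundary_def
    by (simp add: frag_extend_sum[OF finite_Diff[OF finite_circles]] frag_extend_cmul o_def)
  also have "\<dots> = (\<Sum>k\<in>{..<ncross D} - s. frag_cmul ((- 1) ^ card {l\<in>s. l < k})
      (\<Sum>w\<in>circles D s - {c}. frag_cmul (\<sigma> w) (edge_map D s k (?\<epsilon> w))))"
    unfolding framed_boundary_frag_of frag_cmul_sum
    by (subst sum.swap) (simp add: mult.commute)
  also have "\<dots> = 0" using edge by (intro sum.neutral) auto
  finally show ?thesis .
qed

text \<open>As \<open>w\<close> differs from \<open>c\<close>, exactly two circles carry w_-, and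
  each of them lowers the maximal degree by 4.\<close>

lemma keys_cycle:
  assumes "(card s + card (circles D {})) mod 2 = i"
    and "2 * (int (card (circles D s)) - 4) + (int (ncross D) - 2 * int (card s)) = j"
  shows "Poly_Mapping.keys cycle \<subseteq> framed_basis D i j"
proof -
  have "(s, gen {c, w}) \<in> framed_basis D i j" if w: "w \<in> circles D s - {c}" for w
  proof -
    have "(\<Sum>Z\<in>circles D s. wdeg (gen {c, w} Z)) = (\<Sum>Z\<in>circles D s. 2 - (if Z \<in> {c, w} then 4 else 0))"
      by (rule sum.cong) (auto simp: gen_def)
    also have "\<dots> = 2 * int (card (circles D s)) - (\<Sum>Z\<in>circles D s. if Z \<in> {c, w} then 4 else 0)"
      by (simp add: sum_subtractf)
    also have "(\<Sum>Z\<in>circles D s. if Z \<in> {c, w} then 4 else 0) = (\<Sum>Z\<in>{c, w}. 4 :: int)"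
      using w cuv finite_circles by (intro sum.mono_neutral_cong_right) auto
    also have "\<dots> = 8" using w by (auto simp: card_insert_if)
    finally show ?thesis
      using assms s a_minus_b_eq[OF s] by (auto simp: framed_basis_def W_basis_def edeg_def gen_def)
  qed
  then have "Poly_Mapping.keys (frag_cmul (\<sigma> w) (frag_of (s, gen {c, w}))) \<subseteq> framed_basis D i j"
    if "w \<in> circles D s - {c}" for w
    using keys_cmul[of "\<sigma> w" "frag_of (s, gen {c, w})"] that unfolding keys_frag_of by blast
  then show ?thesis
    unfolding cycle_def by (intro order_trans[OF keys_sum] UN_least)
qed

lemma homology_nontrivial:
  assumes "(card s + card (circles D {})) mod 2 = i"
    and "2 * (int (card (circles D s)) - 4) + (int (ncross D) - 2 * int (card s)) = j"
  obtains A B where "A \<in> carrier (framed_homology D i j)" "B \<in> carrier (framed_homology D i j)" "A \<noteq> B"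
proof (rule framed_homology_nontrivial[OF keys_cycle[OF assms] boundary_cycle])
  fix x
  show "framed_boundary D x \<noteq> cycle"
    using cocycle_boundary[of x] cocycle_cycle by auto
qed (rule that)

end

section \<open>The two knots\<close>

text \<open>The code read off the grid in \<open>framed_knot_ten132\<close>. Crossings 0, 2 and 9
  are the negative ones.\<close>

definition ten132_crossings :: "crossing list" where
  "ten132_crossings = [Cr 21 16 0 17, Cr 2 8 3 7, Cr 1 20 2 21, Cr 5 13 6 12, Cr 6 4 7 3, Cr 8 20 9 19, Cr 10 16 11 15, Cr 13 5 14 4, Cr 14 12 15 11, Cr 17 0 18 1, Cr 18 10 19 9]"

definition ten132 :: diagram where
  "ten132 = \<lparr>arcs = {..<22}, crossings = ten132_crossings\<rparr>"

definition torus25_crossings :: "crossing list" where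
  "torus25_crossings = [Cr 9 5 0 4, Cr 1 7 2 6, Cr 3 9 4 8, Cr 5 1 6 0, Cr 7 3 8 2]"

definition torus25 :: diagram where
  "torus25 = \<lparr>arcs = {..<10}, crossings = torus25_crossings\<rparr>"

lemma framed_knot_ten132: obtains K where "framed_knot K" "diagram_of ten132 K"
proof -
  \<comment> \<open>The grid has 10 horizontal and 10 vertical segments. \<open>?T\<close> measures
    time in segments; the first two entries of each member of \<open>?L\<close> are positions in
    \<open>?T\<close>.\<close>
  let ?X = "[5, 7, 2, 0, 3, 8, 4, 1, 6, 9] :: int list" and ?Y = "[4, 7, 1, 5, 8, 3, 0, 2, 6, 9] :: int list"
  let ?L = "[(0, 17, 0, 7), (3, 8, 1, 3), (2, 21, 1, 9), (6, 13, 2, 6), (7, 4, 3, 1), (9, 20, 4, 9), (11, 16, 5, 7), (14, 5, 7, 1), (15, 12, 7, 5), (18, 1, 8, 0), (19, 10, 8, 4)] :: (nat \<times> nat \<times> nat \<times> nat) list"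
  let ?T = "[1/2, 5/3, 12/5, 14/5, 10/3, 23/6, 9/2, 20/3, 23/3, 42/5, 47/5, 21/2, 34/3, 27/2, 71/5, 73/5, 61/4, 31/2, 49/3, 50/3, 96/5, 97/5] :: real list"
  interpret grid 10 "cyc ?X" "cyc ?Y" by (rule grid_cyc) simp_all
  have "knot_projection \<lparr>arcs = {..<2 * length ?L}, crossings = map (grid_crossing (length ?L)) ?L\<rparr> curve height"
  proof (rule knot_projection_grid[of ?L ?T])
    show "mset (map fst ?L @ map (fst \<circ> snd) ?L) = mset [0..<2 * length ?L]"
      by (rule mset_eq_if_sort) code_simp
    show "\<forall>(u, v, i, j) \<in> set ?L. i < 10 \<and> j < 10 \<and> crosses i j \<and>
        ?T ! u = under_time i j \<and> ?T ! v = over_time i j"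
      by (simp add: crosses_def under_time_def over_time_def cyc_def)
    have "\<forall>i\<in>set [0..<10]. \<forall>j\<in>set [0..<10]. crosses_int ?X ?Y i j \<longrightarrow> (i, j) \<in> set (map (snd \<circ> snd) ?L)"
      by code_simp
    then show "\<forall>i<10. \<forall>j<10. crosses i j \<longrightarrow> (i, j) \<in> set (map (snd \<circ> snd) ?L)"
      unfolding crosses_def crosses_int by (simp only: Ball_def set_upt atLeastLessThan_iff le0 simp_thms)
  qed simp_all
  also have "\<lparr>arcs = {..<2 * length ?L}, crossings = map (grid_crossing (length ?L)) ?L\<rparr> = ten132"
    by (simp add: ten132_def ten132_crossings_def grid_crossing_def cyc_def)
  finally show thesis using diagram_of_vertical_band that by blast
qed

lemma framed_knot_torus25: obtains K where "framed_knot K" "diagram_of torus25 K"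
proof -
  let ?X = "[5, 3, 1, 6, 4, 2, 0] :: int list" and ?Y = "[2, 4, 6, 1, 3, 5, 0] :: int list"
  let ?L = "[(0, 5, 0, 3), (2, 7, 1, 4), (4, 9, 3, 6), (6, 1, 4, 0), (8, 3, 5, 1)] :: (nat \<times> nat \<times> nat \<times> nat) list"
  let ?T = "[1/2, 3/2, 5/2, 7/2, 13/2, 15/2, 17/2, 19/2, 21/2, 27/2] :: real list"
  interpret grid 7 "cyc ?X" "cyc ?Y" by (rule grid_cyc) simp_all
  have "knot_projection \<lparr>arcs = {..<2 * length ?L}, crossings = map (grid_crossing (length ?L)) ?L\<rparr> curve height"
  proof (rule knot_projection_grid[of ?L ?T])
    show "mset (map fst ?L @ map (fst \<circ> snd) ?L) = mset [0..<2 * length ?L]"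
      by (rule mset_eq_if_sort) code_simp
    show "\<forall>(u, v, i, j) \<in> set ?L. i < 7 \<and> j < 7 \<and> crosses i j \<and>
        ?T ! u = under_time i j \<and> ?T ! v = over_time i j"
      by (simp add: crosses_def under_time_def over_time_def cyc_def)
    have "\<forall>i\<in>set [0..<7]. \<forall>j\<in>set [0..<7]. crosses_int ?X ?Y i j \<longrightarrow> (i, j) \<in> set (map (snd \<circ> snd) ?L)"
      by code_simp
    then show "\<forall>i<7. \<forall>j<7. crosses i j \<longrightarrow> (i, j) \<in> set (map (snd \<circ> snd) ?L)"
      unfolding crosses_def crosses_int by (simp only: Ball_def set_upt atLeastLessThan_iff le0 simp_thms)
  qed simp_all
  also have "\<lparr>arcs = {..<2 * length ?L}, crossings = map (grid_crossing (length ?L)) ?L\<rparr> = torus25"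
    by (simp add: torus25_def torus25_crossings_def grid_crossing_def cyc_def)
  finally show thesis using diagram_of_vertical_band that by blast
qed

lemma closed_ten132: "closed_diagram ten132"
  by (simp add: closed_diagram_def ten132_def ten132_crossings_def)

lemma closed_torus25: "closed_diagram torus25"
  by (simp add: closed_diagram_def torus25_def torus25_crossings_def)

text \<open>Up to a power of y, both state sums are 1 + y^2 + y^4 - y^12. The remaining powers of A
  agree because 55 - 2 * 23 = 25 - 2 * 8 = 9; unequal framings would show up here.\<close>

lemma same_bracket: "kauffman_bracket ten132 = kauffman_bracket torus25"
proof (rule same_kauffman_bracket[OF closed_ten132 closed_torus25])
  have "state_sum [] ten132_crossings = replicate 23 0 @ [1, 0, 1, 0, 1, 0, 0, 0, 0, 0, 0, 0, - 1]"
    by code_simp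
  then show "state_sum [] (crossings ten132) = replicate 23 0 @ [1, 0, 1, 0, 1, 0, 0, 0, 0, 0, 0, 0, - 1]"
    by (simp only: ten132_def diagram.simps)
  have "state_sum [] torus25_crossings = replicate 8 0 @ [1, 0, 1, 0, 1, 0, 0, 0, 0, 0, 0, 0, - 1]"
    by code_simp
  then show "state_sum [] (crossings torus25) = replicate 8 0 @ [1, 0, 1, 0, 1, 0, 0, 0, 0, 0, 0, 0, - 1]"
    by (simp only: torus25_def diagram.simps)
qed (simp add: ten132_def ten132_crossings_def torus25_def torus25_crossings_def)

text \<open>The degree is largest when all circles carry w_+. The best of the 32 states is the all-A
  state with its two circles, which reaches only 2 * 2 + 5 = 9.\<close>

lemma framed_basis_torus25: "framed_basis torus25 i 13 = {}"
proof -
  have "\<forall>xs\<in>set (subseqs [0..<5]).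
      2 * int (loops (smoothings 0 (set xs) torus25_crossings)) + (5 - 2 * int (card (set xs))) < 13"
    by code_simp
  then have "\<forall>s\<in>set ` set (subseqs [0..<5]).
      2 * int (loops (smoothings 0 s torus25_crossings)) + (5 - 2 * int (card s)) < 13" by blast
  moreover have "ncross torus25 = 5" by (simp add: torus25_def torus25_crossings_def)
  ultimately have "2 * int (card (circles torus25 s)) + (int (ncross torus25) - 2 * int (card s)) < 13"
    if "s \<in> states torus25" for s
    using that unfolding card_circles[OF closed_torus25]
    by (simp add: subseqs_powset states_def atLeast0LessThan) (simp add: torus25_def)
  then have "edeg torus25 (s, \<epsilon>) \<noteq> 13" if "s \<in> states torus25" for s \<epsilon>
    using edeg_le[OF that, of \<epsilon>] that by (metis leD)
  then show ?thesis unfolding framed_basis_def by auto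
qed

text \<open>Here c = {1, 17, 21}, u = {0, 10, 16, 18} and v = {2, 8, 20}. Crossings 0 and 9 join c
  to u, crossing 2 joins c to v. The third circle of sign 1 is {4, 6, 12, 14}; those of sign -1 are
  {3, 7}, {5, 13}, {9, 19} and {11, 15}.\<close>

lemma seifert_class_ten132:
  defines "C \<equiv> circ ten132 {0, 2, 9}"
  shows "seifert_class ten132 {0, 2, 9} (C 17) (C 18) (C 8) (\<lambda>Z. if Z \<in> {C 8, C 4, C 18} then 1 else - 1)"
proof -
  let ?l = "\<lambda>s. labels (smoothings 0 s ten132_crossings)"
  let ?O = "{0, 2, 9} :: nat set"
  have circ_iff: "circ ten132 s x = circ ten132 s y \<longleftrightarrow> ?l s x = ?l s y" for s x y
    by (simp add: circ_eq_iff ten132_def)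
  have arcs: "C e \<in> circles ten132 ?O" if "e < 22" for e
    using that by (simp add: C_def circles_def ten132_def)
  have distinct: "?l ?O 17 \<noteq> ?l ?O 18 \<and> ?l ?O 17 \<noteq> ?l ?O 8 \<and> ?l ?O 18 \<noteq> ?l ?O 8"
    by code_simp
  have nth: "ten132_crossings ! 0 = Cr 21 16 0 17"
    "ten132_crossings ! 1 = Cr 2 8 3 7"
    "ten132_crossings ! 2 = Cr 1 20 2 21"
    "ten132_crossings ! 3 = Cr 5 13 6 12"
    "ten132_crossings ! 4 = Cr 6 4 7 3"
    "ten132_crossings ! 5 = Cr 8 20 9 19"
    "ten132_crossings ! 6 = Cr 10 16 11 15"
    "ten132_crossings ! 7 = Cr 13 5 14 4"
    "ten132_crossings ! 8 = Cr 14 12 15 11"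
    "ten132_crossings ! 9 = Cr 17 0 18 1"
    "ten132_crossings ! 10 = Cr 18 10 19 9"
    by (simp_all add: ten132_crossings_def)
  \<comment> \<open>Inequality of the two truth values says that exactly one end of the crossing
    lies on a circle of sign 1.\<close>
  have merge: "\<forall>k\<in>{1, 3, 4, 5, 6, 7, 8, 10}. (case ten132_crossings ! k of Cr p q r t \<Rightarrow>
      ?l ?O p \<noteq> ?l ?O r \<and> ?l ?O 17 \<noteq> ?l ?O p \<and> ?l ?O 17 \<noteq> ?l ?O r \<and>
      (?l ?O p = ?l ?O 8 \<or> ?l ?O p = ?l ?O 4 \<or> ?l ?O p = ?l ?O 18) \<noteq>
      (?l ?O r = ?l ?O 8 \<or> ?l ?O r = ?l ?O 4 \<or> ?l ?O r = ?l ?O 18) \<and>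
      ?l (insert k ?O) p = ?l (insert k ?O) r)"
    unfolding ball_simps(5,7) nth crossing.case by code_simp
  have split: "\<forall>k\<in>?O. (case ten132_crossings ! k of Cr p q r t \<Rightarrow>
      ?l (?O - {k}) p = ?l (?O - {k}) r \<and>
      (?l ?O p = ?l ?O 17 \<and> (?l ?O r = ?l ?O 18 \<or> ?l ?O r = ?l ?O 8) \<or>
       ?l ?O r = ?l ?O 17 \<and> (?l ?O p = ?l ?O 18 \<or> ?l ?O p = ?l ?O 8)))"
    unfolding ball_simps(5,7) nth crossing.case by code_simp
  have n: "ncross ten132 = 11" by (simp add: ten132_def ten132_crossings_def)
  show ?thesis
  proof
    show "closed_diagram ten132" by (rule closed_ten132)
    show "?O \<in> states ten132" by (simp add: states_def n)
    show "C 17 \<in> circles ten132 ?O" "C 18 \<in> circles ten132 ?O" "C 8 \<in> circles ten132 ?O"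
      by (rule arcs; simp)+
    show "C 17 \<noteq> C 18" "C 17 \<noteq> C 8" "C 18 \<noteq> C 8"
      using distinct by (simp_all add: C_def circ_iff)
    show "(if C 18 \<in> {C 8, C 4, C 18} then 1 else - 1 :: int) = 1"
      "(if C 8 \<in> {C 8, C 4, C 18} then 1 else - 1 :: int) = 1" by simp_all
  next
    fix k p q r t assume k: "k < ncross ten132" "k \<notin> ?O" "crossings ten132 ! k = Cr p q r t"
    have "k < 11" using k(1) unfolding n .
    then have "k \<in> {1, 3, 4, 5, 6, 7, 8, 10}" using k(2) by simp presburger
    moreover have "ten132_crossings ! k = Cr p q r t" using k(3) by (simp add: ten132_def)
    ultimately have "k \<in> {1, 3, 4, 5, 6, 7, 8, 10}" "ten132_crossings ! k = Cr p q r t" .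
    from bspec[OF merge this(1), unfolded this(2) crossing.case]
    show "circ ten132 ?O p \<noteq> circ ten132 ?O r \<and> C 17 \<noteq> circ ten132 ?O p \<and> C 17 \<noteq> circ ten132 ?O r \<and>
        (if circ ten132 ?O p \<in> {C 8, C 4, C 18} then 1 else - 1) +
        (if circ ten132 ?O r \<in> {C 8, C 4, C 18} then 1 else - 1) = (0 :: int) \<and>
        circ ten132 (insert k ?O) p = circ ten132 (insert k ?O) r"
      unfolding C_def insert_iff empty_iff circ_iff by simp
  next
    fix k p q r t assume k: "k \<in> ?O" "crossings ten132 ! k = Cr p q r t"
    then have "ten132_crossings ! k = Cr p q r t" by (simp add: ten132_def)
    from bspec[OF split k(1), unfolded this crossing.case]
    show "circ ten132 (?O - {k}) p = circ ten132 (?O - {k}) r \<and>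
        {circ ten132 ?O p, circ ten132 ?O r} \<in> {{C 17, C 18}, {C 17, C 8}}"
      unfolding C_def insert_iff empty_iff doubleton_eq_iff circ_iff by blast
  qed
qed

theorem mainTheorem8:
  shows "\<exists>K1 K2. framed_knot K1 \<and> framed_knot K2 \<and>
           (\<exists>D1 D2. diagram_of D1 K1 \<and> diagram_of D2 K2 \<and>
              kauffman_bracket D1 = kauffman_bracket D2 \<and>
              \<not> pair_iso (framed_homology D1) (framed_homology D2))"
proof -
  obtain K1 where K1: "framed_knot K1" "diagram_of ten132 K1" by (rule framed_knot_ten132)
  obtain K2 where K2: "framed_knot K2" "diagram_of torus25 K2" by (rule framed_knot_torus25)
  have "loops (smoothings 0 {} ten132_crossings) = 7 \<and> loops (smoothings 0 {0, 2, 9} ten132_crossings) = 8"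
    by code_simp
  then have circles: "card (circles ten132 {}) = 7" "card (circles ten132 {0, 2, 9}) = 8"
    by (simp_all add: card_circles[OF closed_ten132]) (simp_all add: ten132_def)
  \<comment> \<open>The index is the parity of 3 + 7, the degree is 2 * (8 - 4) + (11 - 6).\<close>
  have "(card {0, 2, 9 :: nat} + card (circles ten132 {})) mod 2 = 0"
    "2 * (int (card (circles ten132 {0, 2, 9})) - 4) + (int (ncross ten132) - 2 * int (card {0, 2, 9 :: nat})) = 13"
    unfolding circles by (simp_all add: ten132_def ten132_crossings_def)
  from seifert_class.homology_nontrivial[OF seifert_class_ten132 this]
  obtain A B where "A \<in> carrier (framed_homology ten132 0 13)" "B \<in> carrier (framed_homology ten132 0 13)" "A \<noteq> B"
    by blast
  then have "\<not> pair_iso (framed_homology ten132) (framed_homology torus25)"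
    by (rule not_pair_iso[OF framed_basis_torus25])
  then show ?thesis using K1 K2 same_bracket by blast
qed

end
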